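(* Let $n>m$, $\boldsymbol\lambda=(\lambda_1,\dots,\lambda_m)\in\mathbb{C}^m$, and $f\in L^1(V_{n,m})$. The integral $$(T^{\boldsymbol\lambda}f)(u)=\int_{V_{n,m}} f(v)\,(u'vv'u)^{\boldsymbol\lambda}\,dv$$ converges absolutely for almost all $u\in V_{n,m}$ (for every $f\in L^1(V_{n,m})$) if and only if $\mathrm{Re}\,\lambda_j>j-m-1$ for all $j=1,\dots,m$, and it represents an analytic function of $\boldsymbol\lambda$ in this domain. For such $\boldsymbol\lambda$, the linear operator $T^{\boldsymbol\lambda}$ is bounded on $L^1(V_{n,m})$.
   Context: $V_{n,m}=\{v\in\mathbb{R}^{n\times m}: v'v=I_m\}$ is the Stiefel manifold of orthonormal $m$-frames in $\mathbb{R}^n$ ($v'$ the transpose), with its $O(n)$-invariant measure $dv$. For a positive definite symmetric $m\times m$ matrix $r$ with leading principal minors $\Delta_1(r),\dots,\Delta_m(r)=\det r$ and $\Delta_0(r)=1$, the composite power function is $r^{\boldsymbol\lambda}=\prod_{i=1}^m[\Delta_i(r)/\Delta_{i-1}(r)]^{\lambda_i/2}$ (the matrix $u'vv'u$ is positive definite for almost all $v$). *)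

theory Defs
  imports "HOL-Analysis.Analysis" "HOL-Probability.Probability"
begin

definition stiefel :: "(real^'m^'n) set" where
  "stiefel = {v. transpose v ** v = mat 1}"

text \<open>The O(n)-invariant measure on V_{n,m}: a nonzero finite Borel measure on the
  ambient matrix space, concentrated on V_{n,m}, invariant under left
  multiplication by orthogonal matrices (unique up to a positive factor).\<close>
definition stiefel_invariant_measure :: "(real^'m^'n) measure \<Rightarrow> bool" where
  "stiefel_invariant_measure M \<longleftrightarrow>
     sets M = sets borel \<and>
     emeasure M (UNIV - stiefel) = 0 \<and>
     0 < emeasure M stiefel \<and> emeasure M stiefel < \<infinity> \<and>
     (\<forall>g::real^'n^'n. orthogonal_matrix g \<longrightarrow> distr M M (\<lambda>v. g ** v) = M)"

definition principal_minor :: "real^'m^'m \<Rightarrow> 'm set \<Rightarrow> real" where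
  "principal_minor r S = (\<Sum>p\<in>{p. p permutes S}. of_int (sign p) * (\<Prod>k\<in>S. r $ k $ p k))"

definition idx_pos :: "'m::{finite,linorder} \<Rightarrow> nat" where
  "idx_pos j = card {k. k < j} + 1"

definition comp_power :: "real^('m::{finite,linorder})^('m::{finite,linorder}) \<Rightarrow> complex^('m::{finite,linorder}) \<Rightarrow> complex" where
  "comp_power r lam = (\<Prod>j\<in>(UNIV::'m set).
      complex_of_real (principal_minor r {k. k \<le> j} / principal_minor r {k. k < j})
        powr (lam $ j / 2))"

definition stiefel_domain :: "(complex^('m::{finite,linorder})) set" where
  "stiefel_domain = {lam. \<forall>j. Re (lam $ j) > real (idx_pos j) - real CARD('m) - 1}"

definition T_op :: "(real^(('m::{finite,linorder}))^'n) measure \<Rightarrow> complex^('m::{finite,linorder}) \<Rightarrow> (real^('m::{finite,linorder})^'n \<Rightarrow> complex)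
     \<Rightarrow> real^('m::{finite,linorder})^'n \<Rightarrow> complex" where
  "T_op M lam f u = (\<integral>v. f v * comp_power (transpose u ** v ** transpose v ** u) lam \<partial>M)"

text \<open>Holomorphy in several complex variables: complex Frechet differentiability on an
  open set (equivalent to analyticity).\<close>
definition holomorphic_multi :: "(complex^'m \<Rightarrow> complex) \<Rightarrow> (complex^'m) set \<Rightarrow> bool" where
  "holomorphic_multi F D \<longleftrightarrow> open D \<and>
     (\<forall>z\<in>D. \<exists>L. (F has_derivative L) (at z) \<and> (\<forall>c x. L (c *s x) = c * L x))"

end

theory Submission
  imports Defs
begin

text \<open>
  Write $v'u_j$ for the columns of $v'u$. The ratio $\Delta_j/\Delta_{j-1}$ of Gram minors of $v'u$ is the
  squared distance from $v'u_j$ to the span of its predecessors, so it lies in $[0,1]$ and the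
  kernel is decreasing in every $\mathrm{Re}\,\lambda_j$. As $O(n)$ acts transitively on frames,
  $I = \int |(u'vv'u)^\lambda|\,dv$ does not depend on $u$, and it equals the integral over $u$ for fixed $v$;
  everything is reduced to deciding when $I$ is finite.

  To this end $u$ is averaged over the Gram-Schmidt frames of matrices $X$ whose columns are independent
  and uniform in the unit ball. Gram-Schmidt multiplies the squared distances of $v'X$ and of $X$
  by the same factors, so $I$ becomes an integral of products of ratios of such distances,
  and Fubini exchanges it with the integral over $v$. Integrating out one column after another, starting with the last, the
  $j$-th ratio is $|Ay|^2/|By|^2$ with orthogonal projections whose ranks are $m-j+1$ and
  $n-j+1 > m-j+1$; the integral of its power $\mu_j/2$ over the ball lies between positive constants that do not depend on the
  other columns, and is finite exactly for $\mu_j > -(m-j+1)$.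

  Analyticity follows by dominating the second order remainder of $\lambda \mapsto (u'vv'u)^\lambda$
  by the kernel at a slightly smaller real exponent.
\<close>

section \<open>Gram determinants\<close>

text \<open>The columns of a random frame are dependent, so Fubini cannot integrate them one at a
  time; independent columns in the ball restore the product structure. The law of the resulting
  Gram-Schmidt frame is never identified: since I is the same for every frame, any law on frames
  yields I times its mass, and dependent tuples contribute 0.

  The strict inequality m < n enters through the denominators. It leaves a unit vector b orthogonal
  both to the range of A and to the earlier columns, so |By| >= |b.y| can be kept away from 0 while
  Ay tends to 0. The singularity of the ratio is then that of a negative power of |Ay| on a space of
  dimension m-j+1, which is the source of the threshold. The bounds have to be uniform in the
  earlier columns because those are integrated afterwards.

  Necessity is tested on f = 1. In the analyticity claim the exceptional null set of u has to be
  fixed before lambda, so integrability is first secured for countably many exponents approaching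
  the boundary of the domain and then extended by monotonicity of the kernel.\<close>

lemma principal_minor_cong:
  assumes "\<And>i k. i \<in> S \<Longrightarrow> k \<in> S \<Longrightarrow> r $ i $ k = r' $ i $ k"
  shows "principal_minor r S = principal_minor r' S"
  unfolding principal_minor_def
proof (rule sum.cong[OF refl])
  fix p assume "p \<in> {p. p permutes S}"
  hence "p k \<in> S" if "k \<in> S" for k using permutes_in_image that by fastforce
  thus "of_int (sign p) * (\<Prod>k\<in>S. r $ k $ p k) = of_int (sign p) * (\<Prod>k\<in>S. r' $ k $ p k)"
    using assms by (simp cong: prod.cong)
qed

text \<open>Padding with the identity outside S makes the row operations for \<open>det\<close>
  available to minors. A permutation that moves a point outside S meets a zero entry of the
  padding.\<close>

lemma principal_minor_eq_det:
  fixes r :: "real^'m^'m"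
  shows "principal_minor r S =
    det (\<chi> i k. if i \<in> S \<and> k \<in> S then r $ i $ k else if i = k then 1 else 0)"
proof -
  let ?A = "(\<chi> i k. if i \<in> S \<and> k \<in> S then r $ i $ k else if i = k then 1 else 0) :: real^'m^'m"
  have "det ?A = (\<Sum>p | p permutes UNIV. of_int (sign p) * (\<Prod>i\<in>UNIV. ?A $ i $ p i))"
    by (simp add: det_def)
  also have "\<dots> = (\<Sum>p | p permutes S. of_int (sign p) * (\<Prod>i\<in>UNIV. ?A $ i $ p i))"
  proof (rule sum.mono_neutral_right)
    show "{p. p permutes S} \<subseteq> {p. p permutes (UNIV::'m set)}"
      by (auto intro: permutes_subset)
    show "\<forall>p\<in>{p. p permutes UNIV} - {p. p permutes S}.
       of_int (sign p) * (\<Prod>i\<in>UNIV. ?A $ i $ p i) = 0"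
    proof
      fix p :: "'m \<Rightarrow> 'm" assume p: "p \<in> {p. p permutes UNIV} - {p. p permutes S}"
      have "\<exists>i. i \<notin> S \<and> p i \<noteq> i"
      proof (rule ccontr)
        assume "\<not> ?thesis"
        hence "p permutes S" using p
          by (auto simp: permutes_def)
        thus False using p by simp
      qed
      then obtain i where "i \<notin> S" "p i \<noteq> i" by blast
      hence "?A $ i $ p i = 0" by auto
      hence "(\<Prod>i\<in>UNIV. ?A $ i $ p i) = 0"
        by (rule prod_zero[OF finite bexI[OF _ UNIV_I]])
      thus "of_int (sign p) * (\<Prod>i\<in>UNIV. ?A $ i $ p i) = 0" by simp
    qed
  qed (simp add: finite_permutations)
  also have "\<dots> = principal_minor r S"
    unfolding principal_minor_def
  proof (rule sum.cong[OF refl])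
    fix p assume "p \<in> {p. p permutes S}"
    hence pS: "p permutes S" by simp
    have "(\<Prod>i\<in>UNIV. ?A $ i $ p i) = (\<Prod>i\<in>S. ?A $ i $ p i)"
      by (rule prod.mono_neutral_right) (auto simp: permutes_not_in[OF pS])
    also have "\<dots> = (\<Prod>i\<in>S. r $ i $ p i)"
      by (rule prod.cong) (auto simp: permutes_in_image[OF pS])
    finally show "of_int (sign p) * (\<Prod>i\<in>UNIV. ?A $ i $ p i) = of_int (sign p) * (\<Prod>k\<in>S. r $ k $ p k)"
      by simp
  qed
  finally show ?thesis by simp
qed

text \<open>Expansion along a row that is zero off the diagonal: a permutation moving j picks up a
  zero factor from row j.\<close>

lemma principal_minor_insert:
  fixes r :: "real^'m^'m"
  assumes j: "j \<notin> S" and z: "\<And>k. k \<in> S \<Longrightarrow> r $ j $ k = 0"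
  shows "principal_minor r (insert j S) = r $ j $ j * principal_minor r S"
proof -
  have fin: "finite {p. p permutes T}" for T :: "'m set"
    by (simp add: finite_permutations)
  have "principal_minor r (insert j S) =
    (\<Sum>p | p permutes S. of_int (sign p) * (\<Prod>k\<in>insert j S. r $ k $ p k))"
    unfolding principal_minor_def
  proof (rule sum.mono_neutral_right)
    show "{p. p permutes S} \<subseteq> {p. p permutes insert j S}"
      by (auto intro: permutes_subset)
    show "\<forall>p\<in>{p. p permutes insert j S} - {p. p permutes S}.
       of_int (sign p) * (\<Prod>k\<in>insert j S. r $ k $ p k) = 0"
    proof
      fix p assume p: "p \<in> {p. p permutes insert j S} - {p. p permutes S}"
      have "p j \<noteq> j"
      proof
        assume "p j = j"
        hence "p permutes S" using p permutes_superset[of p "insert j S" S] by auto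
        thus False using p by simp
      qed
      moreover have "p j \<in> insert j S" using p permutes_in_image[of p "insert j S" j] by auto
      ultimately have "r $ j $ p j = 0" using z by auto
      thus "of_int (sign p) * (\<Prod>k\<in>insert j S. r $ k $ p k) = 0"
        using j by simp
    qed
  qed (simp add: fin)
  also have "\<dots> = (\<Sum>p | p permutes S. of_int (sign p) * (r $ j $ j * (\<Prod>k\<in>S. r $ k $ p k)))"
    using j by (intro sum.cong refl) (auto simp: permutes_not_in)
  finally show ?thesis
    by (simp add: principal_minor_def sum_distrib_left algebra_simps)
qed

section \<open>Gram determinants as products of squared distances\<close>

definition gram :: "('m::finite \<Rightarrow> 'a::real_inner) \<Rightarrow> 'm set \<Rightarrow> real" where
  "gram w S = principal_minor (\<chi> i k. w i \<bullet> w k) S"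

lemma gram_empty [simp]: "gram w {} = 1"
  by (simp add: gram_def principal_minor_def)

lemma gram_cong: "(\<And>i. i \<in> S \<Longrightarrow> w i = w' i) \<Longrightarrow> gram w S = gram w' S"
  unfolding gram_def by (rule principal_minor_cong) simp

text \<open>Subtracting from row j the combination of the rows in S that represents z turns its
  entries into (w j - z) . w k. These vanish for k in S, so \<open>principal_minor_insert\<close>
  splits off the diagonal entry, which is the squared norm because w j - z is orthogonal to
  z.\<close>

lemma gram_insert:
  fixes w :: "'m::finite \<Rightarrow> 'a::real_inner"
  assumes j: "j \<notin> S" and z: "z \<in> span (w ` S)"
    and orth: "\<And>k. k \<in> S \<Longrightarrow> (w j - z) \<bullet> w k = 0"
  shows "gram w (insert j S) = (norm (w j - z))\<^sup>2 * gram w S"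
proof -
  let ?I = "insert j S"
  let ?E = "\<lambda>r::real^'m^'m. (\<chi> i k. if i \<in> ?I \<and> k \<in> ?I then r $ i $ k else if i = k then 1 else 0) :: real^'m^'m"
  define r where "r = (\<chi> i k. w i \<bullet> w k)"
  define r' where "r' = (\<chi> i k. if i = j then (w j - z) \<bullet> w k else w i \<bullet> w k)"
  \<comment> \<open>The coefficients of z in terms of the vectors w i are transferred to the padded
    rows. Entries outside \<open>insert j S\<close> stay 0, since a padded row with index in S
    vanishes there.\<close>
  have "\<exists>x. x \<in> span {row i (?E r) | i. i \<in> S} \<and> (\<forall>k. x $ k = (if k \<in> ?I then z \<bullet> w k else 0))"
    using z
  proof (induction rule: span_induct_alt)
    case base
    show ?case by (rule exI[of _ 0]) (auto simp: span_0)
  next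
    case (step c y z')
    then obtain x i where x: "x \<in> span {row i (?E r) | i. i \<in> S}"
        "\<And>k. x $ k = (if k \<in> ?I then z' \<bullet> w k else 0)" and i: "i \<in> S" "y = w i" by auto
    have "c *\<^sub>R row i (?E r) + x \<in> span {row i (?E r) | i. i \<in> S}"
      using i by (intro span_add span_scale x(1) span_base) auto
    moreover have "(c *\<^sub>R row i (?E r) + x) $ k = (if k \<in> ?I then (c *\<^sub>R y + z') \<bullet> w k else 0)" for k
      using i j by (auto simp: x(2) row_def r_def inner_add_left)
    ultimately show ?case by blast
  qed
  then obtain x where x: "x \<in> span {row i (?E r) | i. i \<in> S}"
    "\<And>k. x $ k = (if k \<in> ?I then z \<bullet> w k else 0)" by blast
  have "det (\<chi> i. if i = j then row j (?E r) + (- x) else row i (?E r)) = det (?E r)"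
  proof (rule det_row_span)
    have "{row i (?E r) | i. i \<in> S} \<subseteq> {row i (?E r) | i. i \<noteq> j}" using j by auto
    hence "x \<in> span {row i (?E r) | i. i \<noteq> j}" using x(1) span_mono by blast
    thus "- x \<in> vec.span {row i (?E r) | i. i \<noteq> j}"
      by (simp add: span_vec_eq span_neg)
  qed
  moreover have "(\<chi> i. if i = j then row j (?E r) + (- x) else row i (?E r)) = ?E r'"
    by (auto simp: vec_eq_iff x(2) row_def r_def r'_def inner_diff_left)
  ultimately have "gram w ?I = principal_minor r' ?I"
    unfolding gram_def principal_minor_eq_det[of _ ?I] r_def[symmetric] by simp
  also have "\<dots> = r' $ j $ j * principal_minor r' S"
    by (rule principal_minor_insert[OF j]) (simp add: r'_def orth)
  also have "principal_minor r' S = gram w S"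
    unfolding gram_def using j by (intro principal_minor_cong) (auto simp: r'_def)
  also have "r' $ j $ j = (norm (w j - z))\<^sup>2"
  proof -
    have "(w j - z) \<bullet> z = 0"
      using orthogonal_to_span[OF z, of "w j - z"] orth by (auto simp: orthogonal_def)
    thus ?thesis by (simp add: r'_def power2_norm_eq_inner inner_diff_right)
  qed
  finally show ?thesis .
qed

lemma infdist_span_eq:
  fixes y :: "'a::real_inner"
  assumes z: "z \<in> span B" and orth: "\<And>b. b \<in> B \<Longrightarrow> (y - z) \<bullet> b = 0"
  shows "infdist y (span B) = norm (y - z)"
proof (rule antisym)
  show "infdist y (span B) \<le> norm (y - z)"
    using infdist_le[OF z, of y] by (simp add: dist_norm)
  have "norm (y - z) \<le> dist y a" if "a \<in> span B" for a
  proof -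
    have "z - a \<in> span B" using z that by (rule span_diff)
    hence "(y - z) \<bullet> (z - a) = 0"
      using orthogonal_to_span[of "z - a" B "y - z"] orth by (auto simp: orthogonal_def)
    hence "(norm ((y - z) + (z - a)))\<^sup>2 = (norm (y - z))\<^sup>2 + (norm (z - a))\<^sup>2"
      by (intro norm_add_Pythagorean) (simp add: orthogonal_def)
    hence "(norm (y - z))\<^sup>2 \<le> (norm (y - a))\<^sup>2" by simp
    thus ?thesis by (simp add: dist_norm)
  qed
  moreover have "span B \<noteq> {}" using z by auto
  ultimately show "norm (y - z) \<le> infdist y (span B)"
    by (auto simp: infdist_notempty intro!: cINF_greatest)
qed

lemma span_projection_exists:
  fixes y :: "'a::euclidean_space"
  obtains z where "z \<in> span B" "\<And>b. b \<in> span B \<Longrightarrow> (y - z) \<bullet> b = 0"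
    "infdist y (span B) = norm (y - z)"
proof -
  obtain z x where *: "z \<in> span B" "\<And>w. w \<in> span B \<Longrightarrow> orthogonal x w" "y = z + x"
    using orthogonal_subspace_decomp_exists[of B y] by metis
  have "(y - z) \<bullet> b = 0" if "b \<in> span B" for b using *(2)[OF that] *(3) by (simp add: orthogonal_def)
  with *(1) that infdist_span_eq[of z B y] show ?thesis by (metis span_base)
qed

lemma gram_insert_infdist:
  fixes w :: "'m::finite \<Rightarrow> 'a::euclidean_space"
  assumes "j \<notin> S"
  shows "gram w (insert j S) = (infdist (w j) (span (w ` S)))\<^sup>2 * gram w S"
proof -
  obtain z where z: "z \<in> span (w ` S)" "\<And>b. b \<in> span (w ` S) \<Longrightarrow> (w j - z) \<bullet> b = 0"
    "infdist (w j) (span (w ` S)) = norm (w j - z)"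
    using span_projection_exists[of "w ` S" "w j"] by metis
  show ?thesis unfolding z(3)
    by (rule gram_insert[OF assms z(1)]) (auto intro: z(2) span_base)
qed

lemma gram_nonneg: "gram (w :: 'm::finite \<Rightarrow> 'a::euclidean_space) S \<ge> 0"
proof -
  have "finite S" by simp
  thus ?thesis by (induction S) (auto simp: gram_insert_infdist)
qed

lemma gram_nonzero_dim:
  fixes w :: "'m::finite \<Rightarrow> 'a::euclidean_space"
  assumes "gram w S \<noteq> 0"
  shows "dim (w ` S) = card S"
proof -
  have "finite S" by simp
  thus ?thesis using assms
  proof (induction S)
    case (insert j S)
    hence g: "gram w S \<noteq> 0" and "infdist (w j) (span (w ` S)) \<noteq> 0"
      by (auto simp: gram_insert_infdist)
    hence "w j \<notin> span (w ` S)" by (metis infdist_zero)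
    thus ?case using insert g by (simp add: dim_insert)
  qed simp
qed

lemma infdist_span_linear_le:
  fixes P :: "'a::euclidean_space \<Rightarrow> 'b::euclidean_space"
  assumes "linear P" "\<And>x. norm (P x) \<le> norm x"
  shows "infdist (P y) (span (P ` B)) \<le> infdist y (span B)"
proof -
  obtain z where z: "z \<in> span B" "infdist y (span B) = norm (y - z)"
    using span_projection_exists[of B y] by metis
  have "P z \<in> span (P ` B)" using z(1) linear_span_image[OF assms(1), of B] by auto
  hence "infdist (P y) (span (P ` B)) \<le> norm (P y - P z)"
    using infdist_le by (fastforce simp: dist_norm)
  also have "\<dots> = norm (P (y - z))" by (simp add: linear_diff[OF assms(1)])
  also have "\<dots> \<le> norm (y - z)" by (rule assms(2))
  finally show ?thesis using z(2) by simp
qed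

text \<open>The heights shrink one by one. Applied to \<open>transpose v\<close>, this shows that
  columns are independent whenever their images are.\<close>

lemma gram_contraction:
  fixes P :: "'a::euclidean_space \<Rightarrow> 'b::euclidean_space" and w :: "'m::finite \<Rightarrow> 'a"
  assumes "linear P" "\<And>x. norm (P x) \<le> norm x"
  shows "gram (\<lambda>i. P (w i)) S \<le> gram w S"
proof -
  have "finite S" by simp
  thus ?thesis
  proof (induction S)
    case (insert j S)
    have "infdist (P (w j)) (span ((\<lambda>i. P (w i)) ` S)) \<le> infdist (w j) (span (w ` S))"
      using infdist_span_linear_le[OF assms, of "w j" "w ` S"] by (simp add: image_image)
    thus ?case using insert
      by (auto simp: gram_insert_infdist intro!: mult_mono power_mono gram_nonneg infdist_nonneg)
  qed simp
qed

text \<open>Adding a vector from the span of the predecessors does not change the height over that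
  span, so each height only scales by the absolute value of c j. Equality of the spans is carried
  through the induction because the heights of w' are taken over the span of w'.\<close>

lemma gram_triangular:
  fixes w w' :: "'m::{finite,linorder} \<Rightarrow> 'a::euclidean_space"
  assumes "\<And>j. w' j - c j *\<^sub>R w j \<in> span (w ` {..<j})" and c: "\<And>j. c j \<noteq> 0"
    and "\<And>i k. k \<in> S \<Longrightarrow> i < k \<Longrightarrow> i \<in> S"
  shows "gram w' S = (\<Prod>k\<in>S. (c k)\<^sup>2) * gram w S \<and> span (w' ` S) = span (w ` S)"
proof -
  have "finite S" by simp
  thus ?thesis using assms(3)
  proof (induction S rule: finite_linorder_max_induct)
    case (insert j A)
    \<comment> \<open>Since S is downward closed, the indices below its greatest element j are all
      the predecessors of j.\<close>
    have A: "A = {..<j}" using insert.hyps insert.prems by fastforce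
    have IH: "gram w' A = (\<Prod>k\<in>A. (c k)\<^sup>2) * gram w A" "span (w' ` A) = span (w ` A)"
      using insert.IH unfolding A by (auto simp: A)
    define V where "V = w ` A"
    define x where "x = w' j - c j *\<^sub>R w j"
    have x: "x \<in> span V" "w' j = c j *\<^sub>R w j + x"
      using assms(1)[of j] by (simp_all add: A V_def x_def)
    obtain z where z: "z \<in> span V" "\<And>b. b \<in> span V \<Longrightarrow> (w j - z) \<bullet> b = 0"
      "infdist (w j) (span V) = norm (w j - z)"
      using span_projection_exists[of V "w j"] by metis
    have z': "c j *\<^sub>R z + x \<in> span V" using x z by (intro span_add span_scale)
    have "w' j - (c j *\<^sub>R z + x) = c j *\<^sub>R (w j - z)" by (simp add: x algebra_simps)
    hence "infdist (w' j) (span V) = \<bar>c j\<bar> * infdist (w j) (span V)"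
      using infdist_span_eq[OF z', of "w' j"] z by (simp add: span_base)
    hence "gram w' (insert j A) = (\<Prod>k\<in>insert j A. (c k)\<^sup>2) * gram w (insert j A)"
      using IH insert.hyps by (subst (1 2) gram_insert_infdist)
        (auto simp: A V_def power_mult_distrib)
    moreover have "span (w' ` insert j A) = span (w ` insert j A)"
    proof -
      have "span (insert (w' j) (w' ` A)) = span (insert (w j) (w ` A))"
      proof (rule span_eq[THEN iffD2], intro conjI)
        have V: "V \<subseteq> span (insert (w j) (w ` A))" "span V \<subseteq> span (insert (w j) (w ` A))"
          unfolding V_def by (auto intro: span_base span_mono[THEN subsetD])
        have "w' ` A \<subseteq> span V" using IH(2) unfolding V_def by (metis span_superset)
        moreover have "w' j \<in> span (insert (w j) (w ` A))"
          unfolding x(2) using x(1) V by (intro span_add span_scale) (auto intro: span_base)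
        ultimately show "insert (w' j) (w' ` A) \<subseteq> span (insert (w j) (w ` A))"
          using V by auto
        have V': "span V \<subseteq> span (insert (w' j) (w' ` A))"
          unfolding V_def IH(2)[symmetric] by (intro span_mono) auto
        have "w j = (1 / c j) *\<^sub>R (w' j - x)" using c[of j] by (simp add: x(2))
        moreover have "(1 / c j) *\<^sub>R (w' j - x) \<in> span (insert (w' j) (w' ` A))"
          using x(1) V' by (intro span_scale span_diff) (auto intro: span_base)
        ultimately have "w j \<in> span (insert (w' j) (w' ` A))" by metis
        moreover have "w ` A \<subseteq> span V" unfolding V_def by (rule span_superset)
        ultimately show "insert (w j) (w ` A) \<subseteq> span (insert (w' j) (w' ` A))"
          using V' by auto
      qed
      thus ?thesis by simp
    qed
    ultimately show ?case by blast
  qed simp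
qed

text \<open>When the predecessors of \<open>w j\<close> are dependent, \<open>rho w j\<close> is $0$ by division by zero.\<close>

definition rho :: "('m::{finite,linorder} \<Rightarrow> 'a::real_inner) \<Rightarrow> 'm \<Rightarrow> real" where
  "rho w j = gram w {..j} / gram w {..<j}"

lemma atMost_insert: "{..j} = insert j {..<j::'m::linorder}" by auto

lemma rho_infdist:
  fixes w :: "'m::{finite,linorder} \<Rightarrow> 'a::euclidean_space"
  assumes "gram w {..<j} \<noteq> 0"
  shows "rho w j = (infdist (w j) (span (w ` {..<j})))\<^sup>2"
  using assms unfolding rho_def atMost_insert by (simp add: gram_insert_infdist)

lemma rho_nonneg: "rho (w :: 'm::{finite,linorder} \<Rightarrow> 'a::euclidean_space) j \<ge> 0"
  by (simp add: rho_def gram_nonneg)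

lemma rho_cong: "(\<And>i. i \<le> j \<Longrightarrow> w i = w' i) \<Longrightarrow> rho w j = rho w' j"
  unfolding rho_def by (metis (no_types, lifting) atMost_iff gram_cong less_imp_le lessThan_iff)

lemma rho_le_norm:
  fixes w :: "'m::{finite,linorder} \<Rightarrow> 'a::euclidean_space"
  shows "rho w j \<le> (norm (w j))\<^sup>2"
proof (cases "gram w {..<j} = 0")
  case False
  have "infdist (w j) (span (w ` {..<j})) \<le> norm (w j)"
    using infdist_le[OF span_0, of "w j"] by simp
  thus ?thesis by (simp add: rho_infdist[OF False] infdist_nonneg power_mono)
qed (simp add: rho_def)

text \<open>In the quotient of two consecutive Gram determinants only the last factor survives. It
  is the same for w and for any linear image of w, which is why quotients of two such
  \<open>rho\<close> are unchanged by Gram-Schmidt.\<close>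

lemma rho_triangular:
  fixes w w' :: "'m::{finite,linorder} \<Rightarrow> 'a::euclidean_space"
  assumes "\<And>j. w' j - c j *\<^sub>R w j \<in> span (w ` {..<j})" "\<And>j. c j \<noteq> 0"
  shows "rho w' j = (c j)\<^sup>2 * rho w j"
proof -
  have 1: "gram w' {..j} = (\<Prod>k\<in>{..j}. (c k)\<^sup>2) * gram w {..j}"
    by (rule gram_triangular[THEN conjunct1]) (use assms in auto)
  have 2: "gram w' {..<j} = (\<Prod>k\<in>{..<j}. (c k)\<^sup>2) * gram w {..<j}"
    by (rule gram_triangular[THEN conjunct1]) (use assms in auto)
  show ?thesis unfolding rho_def 1 2 using assms(2) by (simp add: atMost_insert)
qed

lemma gram_nonzero_if_rho_nonzero:
  fixes w :: "'m::{finite,linorder} \<Rightarrow> 'a::euclidean_space"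
  assumes "\<And>i. i < j \<Longrightarrow> rho w i \<noteq> 0"
  shows "gram w {..<j} \<noteq> 0"
proof (cases "{..<j} = {}")
  case False
  \<comment> \<open>For the greatest predecessor k of j the numerator of \<open>rho w k\<close> is
    exactly the Gram determinant over \<open>{..<j}\<close>.\<close>
  define k where "k = Max {..<j}"
  have k: "k \<in> {..<j}" unfolding k_def by (rule Max_in) (use False in auto)
  have "{..k} = {..<j}" using k Max_ge[of "{..<j}"] unfolding k_def by fastforce
  moreover have "gram w {..k} \<noteq> 0" using assms[of k] k by (auto simp: rho_def)
  ultimately show ?thesis by simp
qed simp

text \<open>The squared scale factors are recorded as well: they are the values
  \<open>rho x j\<close> that cancel later against the denominators of the column ratios.\<close>

lemma gram_schmidt:
  fixes x :: "'m::{finite,linorder} \<Rightarrow> 'a::euclidean_space"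
  assumes "\<And>j. rho x j \<noteq> 0"
  obtains u c where "\<And>i k. u i \<bullet> u k = (if i = k then 1 else 0)"
    "\<And>j. c j \<noteq> 0" "\<And>j. x j - c j *\<^sub>R u j \<in> span (u ` {..<j})"
    "\<And>j. (c j)\<^sup>2 = rho x j"
proof -
  define z where "z j = (SOME z. z \<in> span (x ` {..<j}) \<and> (\<forall>b\<in>span (x ` {..<j}). (x j - z) \<bullet> b = 0))" for j
  have z: "z j \<in> span (x ` {..<j})" "b \<in> span (x ` {..<j}) \<Longrightarrow> (x j - z j) \<bullet> b = 0" for j b
  proof -
    have "\<exists>z. z \<in> span (x ` {..<j}) \<and> (\<forall>b\<in>span (x ` {..<j}). (x j - z) \<bullet> b = 0)"
      using span_projection_exists[of "x ` {..<j}" "x j"] by metis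
    from someI_ex[OF this] show "z j \<in> span (x ` {..<j})"
      "b \<in> span (x ` {..<j}) \<Longrightarrow> (x j - z j) \<bullet> b = 0" unfolding z_def by blast+
  qed
  define c where "c j = norm (x j - z j)" for j
  define u where "u j = (1 / c j) *\<^sub>R (x j - z j)" for j
  have g: "gram x {..<j} \<noteq> 0" for j using assms by (rule gram_nonzero_if_rho_nonzero)
  have r: "(c j)\<^sup>2 = rho x j" for j
    unfolding rho_infdist[OF g] c_def
    by (subst infdist_span_eq[OF z(1)]) (auto intro: z(2) span_base)
  have c: "c j \<noteq> 0" for j using assms[of j] r[of j] by auto
  have ort: "u i \<bullet> u k = 0" if "i < k" for i k
  proof -
    have "x i \<in> span (x ` {..<k})" using that by (auto intro: span_base)
    moreover have "z i \<in> span (x ` {..<k})"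
    proof -
      have "x ` {..<i} \<subseteq> x ` {..<k}" using that by auto
      from span_mono[OF this] z(1)[of i] show ?thesis by blast
    qed
    ultimately have "x i - z i \<in> span (x ` {..<k})" by (rule span_diff)
    thus ?thesis using z(2)[of _ k] by (simp add: u_def inner_commute)
  qed
  have on: "u i \<bullet> u k = (if i = k then 1 else 0)" for i k
  proof (cases "i = k")
    case True
    thus ?thesis using c[of i] unfolding u_def c_def
      by (simp add: power2_norm_eq_inner[symmetric] power2_eq_square)
  next
    case False
    thus ?thesis using ort[of i k] ort[of k i] by (metis inner_commute linorder_neqE)
  qed
  \<comment> \<open>Each u j is x j scaled by 1 / c j up to a vector spanned by earlier x, so the
    triangular lemma shows that both families span the same initial subspaces.\<close>
  have "span (u ` {..<j}) = span (x ` {..<j})" for j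
  proof (rule gram_triangular[where c = "\<lambda>j. 1 / c j", THEN conjunct2])
    fix j
    have "u j - (1 / c j) *\<^sub>R x j = - (1 / c j) *\<^sub>R z j" by (simp add: u_def algebra_simps)
    thus "u j - (1 / c j) *\<^sub>R x j \<in> span (x ` {..<j})"
      using span_scale[OF z(1)] by metis
  qed (use c in auto)
  hence "x j - c j *\<^sub>R u j \<in> span (u ` {..<j})" for j
    using z(1)[of j] c[of j] by (simp add: u_def)
  with on c r that show ?thesis by blast
qed

section \<open>Orthogonal invariance of Lebesgue measure\<close>

text \<open>The change of variables theorem of the library covers only well-ordered index types. Here, as in the
  uniqueness proof for Haar measure, two Fubini exchanges compare the image measure with
  Lebesgue measure, the unit ball being invariant under \<open>g\<close>.\<close>

lemma distr_lborel_orthogonal: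
  fixes g :: "'a::euclidean_space \<Rightarrow> 'a"
  assumes g: "orthogonal_transformation g"
  shows "distr lborel borel g = lborel"
proof (rule measure_eqI)
  have lin: "linear g" using g by (rule orthogonal_transformation_linear)
  have [measurable]: "g \<in> borel_measurable borel"
    using lin by (intro borel_measurable_continuous_onI linear_continuous_on) (simp add: linear_conv_bounded_linear)
  obtain h where h: "orthogonal_transformation h" "g \<circ> h = id" "h \<circ> g = id"
    using g orthogonal_transformation_inv[OF g] orthogonal_transformation_bij[OF g]
    by (metis bij_def inv_o_cancel surj_iff)
  hence gh: "g (h x) = x" "h (g x) = x" for x by (metis comp_apply id_apply)+
  fix B assume "B \<in> sets (distr lborel borel g)"
  hence [measurable]: "B \<in> sets borel" by simp
  have [measurable]: "cball (0::'a) 1 \<in> sets borel" by simp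
  let ?C = "cball (0::'a) 1"
  have shift: "(\<integral>\<^sup>+x. f (a + x) \<partial>lborel) = (\<integral>\<^sup>+x. f x \<partial>lborel)"
    if [measurable]: "f \<in> borel_measurable borel" for f :: "'a \<Rightarrow> ennreal" and a
  proof -
    have "(\<integral>\<^sup>+x. f x \<partial>lborel) = (\<integral>\<^sup>+x. f x \<partial>(distr lborel borel ((+) a)))"
      by (simp add: lborel_distr_plus)
    also have "\<dots> = (\<integral>\<^sup>+x. f (a + x) \<partial>lborel)" by (rule nn_integral_distr) auto
    finally show ?thesis ..
  qed
  have "emeasure lborel ?C * emeasure (distr lborel borel g) B
      = (\<integral>\<^sup>+x. indicator ?C x * (\<integral>\<^sup>+y. indicator B (g y) \<partial>lborel) \<partial>lborel)"
  proof -
    have "emeasure (distr lborel borel g) B = (\<integral>\<^sup>+y. indicator B y \<partial>(distr lborel borel g))"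
      by simp
    also have "\<dots> = (\<integral>\<^sup>+y. indicator B (g y) \<partial>lborel)" by (rule nn_integral_distr) auto
    finally show ?thesis by (subst nn_integral_multc) (auto intro: borel_measurable_indicator)
  qed
  \<comment> \<open>For fixed x the inner integral is translated by h x, the preimage of x under g;
    this couples x and y so that the order of integration can be exchanged.\<close>
  also have "\<dots> = (\<integral>\<^sup>+x. (\<integral>\<^sup>+y. indicator ?C x * indicator B (x + g y) \<partial>lborel) \<partial>lborel)"
  proof (rule nn_integral_cong)
    fix x
    have "(\<integral>\<^sup>+y. indicator B (g y) \<partial>lborel) = (\<integral>\<^sup>+y. indicator B (g (h x + y)) \<partial>lborel)"
      by (rule shift[symmetric]) simp
    also have "\<dots> = (\<integral>\<^sup>+y. indicator B (x + g y) \<partial>lborel)"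
      by (simp add: linear_add[OF lin] gh)
    finally show "indicator ?C x * (\<integral>\<^sup>+y. indicator B (g y) \<partial>lborel)
      = (\<integral>\<^sup>+y. indicator ?C x * indicator B (x + g y) \<partial>lborel)"
      by (simp add: nn_integral_cmult)
  qed
  also have "\<dots> = (\<integral>\<^sup>+y. (\<integral>\<^sup>+x. indicator ?C x * indicator B (x + g y) \<partial>lborel) \<partial>lborel)"
    by (rule lborel_pair.Fubini') measurable
  also have "\<dots> = (\<integral>\<^sup>+y. (\<integral>\<^sup>+x. indicator ?C (x - g y) * indicator B x \<partial>lborel) \<partial>lborel)"
  proof (rule nn_integral_cong)
    fix y
    show "(\<integral>\<^sup>+x. indicator ?C x * indicator B (x + g y) \<partial>lborel)
       = (\<integral>\<^sup>+x. indicator ?C (x - g y) * indicator B x \<partial>lborel)"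
      using shift[of "\<lambda>x. indicator ?C (x - g y) * indicator B x" "g y"]
      by (simp add: add.commute)
  qed
  also have "\<dots> = (\<integral>\<^sup>+x. (\<integral>\<^sup>+y. indicator ?C (x - g y) * indicator B x \<partial>lborel) \<partial>lborel)"
    by (rule lborel_pair.Fubini') measurable
  also have "\<dots> = (\<integral>\<^sup>+x. emeasure lborel ?C * indicator B x \<partial>lborel)"
  proof (rule nn_integral_cong)
    fix x
    \<comment> \<open>Here the invariance of the ball enters: h preserves norms and sends x - g y to
      h x - y. A second translation, now by h x, then removes x from the ball factor.\<close>
    have "indicator ?C (x - g y) = (indicator ?C (y - h x) :: ennreal)" for y
    proof -
      have "norm (x - g y) = norm (h (x - g y))"
        using h(1) by (simp add: orthogonal_transformation)
      also have "h (x - g y) = h x - y"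
        using orthogonal_transformation_linear[OF h(1)] by (simp add: linear_diff gh)
      finally show ?thesis by (simp add: indicator_def norm_minus_commute)
    qed
    hence "(\<integral>\<^sup>+y. indicator ?C (x - g y) * indicator B x \<partial>lborel) = (\<integral>\<^sup>+y. indicator ?C (y - h x) \<partial>lborel) * indicator B x"
      by (simp add: nn_integral_multc)
    also have "(\<integral>\<^sup>+y. indicator ?C (y - h x) \<partial>lborel) = (\<integral>\<^sup>+y. indicator ?C y \<partial>lborel)"
      using shift[of "\<lambda>y. indicator ?C (y - h x)" "h x"] by simp
    finally show "(\<integral>\<^sup>+y. indicator ?C (x - g y) * indicator B x \<partial>lborel) = emeasure lborel ?C * indicator B x"
      by simp
  qed
  also have "\<dots> = emeasure lborel ?C * emeasure lborel B"
    by (simp add: nn_integral_cmult)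
  finally have "emeasure lborel ?C * emeasure (distr lborel borel g) B = emeasure lborel ?C * emeasure lborel B" .
  \<comment> \<open>Cancelling a factor in \<open>ennreal\<close> requires it to be neither 0 nor
    infinite.\<close>
  moreover have "emeasure lborel ?C \<noteq> 0" "emeasure lborel ?C \<noteq> \<infinity>"
  proof -
    have "0 < measure lborel ?C" by (rule content_cball_pos) simp
    thus "emeasure lborel ?C \<noteq> 0" by (metis enn2real_0 less_irrefl measure_def)
    show "emeasure lborel ?C \<noteq> \<infinity>"
      using emeasure_bounded_finite[of ?C] by simp
  qed
  ultimately show "emeasure (distr lborel borel g) B = emeasure lborel B"
    by (simp add: ennreal_mult_cancel_left)
qed simp

text \<open>Used twice: to rotate an orthonormal set onto coordinate axes, and to show that the
  orthogonal group acts transitively on frames.\<close>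

lemma orthonormal_extend:
  fixes a :: "'n::finite \<Rightarrow> real^'n"
  assumes on: "\<And>i k. i \<in> K \<Longrightarrow> k \<in> K \<Longrightarrow> a i \<bullet> a k = (if i = k then 1 else 0)"
  obtains g :: "real^'n^'n" where "orthogonal_matrix g" "\<And>i. i \<in> K \<Longrightarrow> g *v axis i 1 = a i"
proof -
  have inj: "inj_on a K"
    by (rule inj_onI) (metis on zero_neq_one)
  have pw: "pairwise orthogonal (a ` K)"
    using on by (auto simp: pairwise_def orthogonal_def)
  obtain U where U: "U \<inter> insert 0 (a ` K) = {}" "pairwise orthogonal (a ` K \<union> U)"
      "span (a ` K \<union> U) = span (a ` K \<union> UNIV)"
    using orthogonal_extension_strong[OF pw, of UNIV] by metis
  define V where "V = (\<lambda>x. x /\<^sub>R norm x) ` U"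
  define B where "B = a ` K \<union> V"
  have n1: "norm b = 1" if "b \<in> B" for b
  proof -
    have "norm (a i) = 1" if "i \<in> K" for i using on[OF that that] by (simp add: norm_eq_1)
    moreover have "x \<noteq> 0" if "x \<in> U" for x using U(1) that by auto
    ultimately show ?thesis using that unfolding B_def V_def by (auto simp: divide_simps)
  qed
  have orth: "x \<bullet> y = 0" if "x \<in> a ` K \<union> U" "y \<in> a ` K \<union> U" "x \<noteq> y" for x y
    using U(2) that by (auto simp: pairwise_def orthogonal_def)
  \<comment> \<open>Disjointness is what lets the cardinalities of the two pieces be added, so that
    the new vectors are exactly as many as the free indices.\<close>
  have disj: "a ` K \<inter> V = {}"
  proof -
    have "a i \<noteq> x /\<^sub>R norm x" if "i \<in> K" "x \<in> U" for i x
    proof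
      assume eq: "a i = x /\<^sub>R norm x"
      have "a i \<bullet> x = 0" using that U(1) by (intro orth) auto
      hence "a i \<bullet> a i = 0" by (subst (2) eq) simp
      thus False using on[OF that(1) that(1)] by simp
    qed
    thus ?thesis unfolding V_def by auto
  qed
  have orthB: "x \<bullet> y = 0" if "x \<in> B" "y \<in> B" "x \<noteq> y" for x y
  proof -
    have *: "a i \<bullet> (x /\<^sub>R norm x) = 0" if "i \<in> K" "x \<in> U" for i x
      using orth[of "a i" x] that U(1) by auto
    have **: "(x /\<^sub>R norm x) \<bullet> (y /\<^sub>R norm y) = 0" if "x \<in> U" "y \<in> U" "x /\<^sub>R norm x \<noteq> y /\<^sub>R norm y" for x y
      using orth[of x y] that by (cases "x = y") auto
    show ?thesis using that * ** orth unfolding B_def V_def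
      by (auto simp: inner_commute)
  qed
  have pwB: "pairwise orthogonal B" using orthB by (auto simp: pairwise_def orthogonal_def)
  have "0 \<notin> B" using n1 by force
  hence indB: "independent B" by (rule pairwise_orthogonal_independent[OF pwB])
  have spB: "span B = UNIV"
  proof -
    have "x \<in> span B" if "x \<in> a ` K \<union> U" for x
    proof (cases "x \<in> a ` K")
      case False
      hence "x /\<^sub>R norm x \<in> span B" using that by (auto simp: B_def V_def intro: span_base)
      from span_scale[OF this, of "norm x"] show ?thesis by (cases "x = 0") (auto simp: span_0)
    qed (auto simp: B_def intro: span_base)
    hence "span (a ` K \<union> U) \<subseteq> span B" by (intro span_minimal) auto
    thus ?thesis using U(3) by (auto simp: span_UNIV)
  qed
  have finB: "finite B" using indB by (rule independent_imp_finite)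
  have "card B = CARD('n)"
    using dim_eq_card[of B UNIV] spB indB dim_eq_card_independent[OF indB] by (metis dim_UNIV dim_span DIM_cart DIM_real mult_1_right)
  moreover have "card B = card K + card V"
    unfolding B_def using finB disj by (subst card_Un_disjoint) (auto simp: B_def card_image[OF inj])
  ultimately have "card (- K) = card V"
    by (simp add: Compl_eq_Diff_UNIV card_Diff_subset)
  then obtain b where b: "bij_betw b (- K) V"
    using finite_same_card_bij[of "- K" V] finB by (auto simp: B_def)
  define c where "c i = (if i \<in> K then a i else b i)" for i
  have cB: "c i \<in> B" for i using b by (auto simp: c_def B_def bij_betw_def)
  have "inj c"
  proof (rule injI)
    fix i k assume eq: "c i = c k"
    have "c i \<in> a ` K \<longleftrightarrow> i \<in> K" for i using b disj by (auto simp: c_def bij_betw_def)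
    hence "i \<in> K \<longleftrightarrow> k \<in> K" using eq by metis
    thus "i = k" using eq inj b by (auto simp: c_def bij_betw_def inj_on_def split: if_splits)
  qed
  hence con: "c i \<bullet> c k = (if i = k then 1 else 0)" for i k
    using orthB[OF cB cB, of i k] n1[OF cB, of i] by (auto simp: norm_eq_1 inj_def)
  define g :: "real^'n^'n" where "g = (\<chi> r i. c i $ r)"
  have "g *v axis i 1 = c i" for i
    by (simp add: g_def matrix_vector_mul_component vec_eq_iff matrix_vector_mult_basis column_def)
  moreover have "orthogonal_matrix g"
    unfolding orthogonal_matrix
    by (auto simp: g_def matrix_matrix_mult_def transpose_def mat_def vec_eq_iff con[unfolded inner_vec_def, simplified])
  ultimately show ?thesis using that[of g] by (auto simp: c_def)
qed

section \<open>Powers of ratios of projections on the unit ball\<close>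

lemma emeasure_lborel_box_cart:
  fixes l u :: "real^'n"
  assumes "\<And>i. l $ i \<le> u $ i"
  shows "emeasure lborel (box l u) = ennreal (\<Prod>i\<in>UNIV. u $ i - l $ i)"
proof -
  have B: "Basis = range (\<lambda>i::'n. axis i (1::real))" by (auto simp: Basis_vec_def)
  have inj: "inj (\<lambda>i::'n. axis i (1::real))" by (auto simp: inj_def axis_eq_axis)
  show ?thesis using assms
    by (subst emeasure_lborel_box) (auto simp: B prod.reindex[OF inj] inner_axis o_def)
qed

lemma emeasure_scaled_box:
  fixes p s :: "'n::finite \<Rightarrow> real"
  assumes "\<And>i. s i \<ge> 0" "q \<ge> 0"
  shows "emeasure lborel (box (\<chi> i. p i - (if i \<in> K then q else 1) * s i) (\<chi> i. p i + (if i \<in> K then q else 1) * s i))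
    = ennreal (q ^ card K * (\<Prod>i\<in>UNIV. 2 * s i))"
proof -
  have "emeasure lborel (box (\<chi> i. p i - (if i \<in> K then q else 1) * s i) (\<chi> i. p i + (if i \<in> K then q else 1) * s i))
    = ennreal (\<Prod>i\<in>UNIV. (if i \<in> K then q else 1) * (2 * s i))"
  proof (subst emeasure_lborel_box_cart)
    fix i
    have "(if i \<in> K then q else 1) * s i \<ge> 0" using assms by simp
    thus "(\<chi> i. p i - (if i \<in> K then q else 1) * s i) $ i \<le> (\<chi> i. p i + (if i \<in> K then q else 1) * s i) $ i"
      unfolding vec_lambda_beta by linarith
  qed (simp add: algebra_simps)
  also have "(\<Prod>i\<in>UNIV. (if i \<in> K then q else 1) * (2 * s i)) = q ^ card K * (\<Prod>i\<in>UNIV. 2 * s i)"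
    by (subst prod.distrib) (simp add: prod.If_cases)
  finally show ?thesis .
qed

text \<open>The ball makes Lebesgue measure finite while keeping its orthogonal invariance. The mass
  is not normalised to 1, since only positivity and finiteness of the resulting constants
  matter.\<close>

definition ballm :: "'a::euclidean_space measure" where
  "ballm = density lborel (indicator (cball 0 1))"

lemma sets_ballm [simp, measurable_cong]: "sets ballm = sets borel"
  by (simp add: ballm_def)

lemma space_ballm [simp]: "space ballm = UNIV"
  by (simp add: ballm_def)

lemma nn_integral_ballm:
  "f \<in> borel_measurable borel \<Longrightarrow> (\<integral>\<^sup>+y. f y \<partial>ballm) = (\<integral>\<^sup>+y. indicator (cball 0 1) y * f y \<partial>lborel)"
  unfolding ballm_def by (rule nn_integral_density) (auto intro: borel_measurable_indicator)

lemma finite_measure_ballm: "finite_measure ballm"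
proof
  have "emeasure ballm (UNIV::'a set) = emeasure lborel (cball (0::'a) 1)"
    unfolding ballm_def by (subst emeasure_density) (auto intro: borel_measurable_indicator)
  thus "emeasure ballm (space ballm :: 'a set) \<noteq> \<infinity>"
    using emeasure_bounded_finite[of "cball (0::'a) 1"] by simp
qed

text \<open>The model case: the squared length of the projection onto the coordinate subspace of K,
  to which every orthogonal projection of the same rank is rotated.\<close>

definition sumsq :: "'n::finite set \<Rightarrow> real^'n \<Rightarrow> real" where
  "sumsq K y = (\<Sum>i\<in>K. (y $ i)\<^sup>2)"

lemma sumsq_nonneg: "sumsq K y \<ge> 0"
  by (simp add: sumsq_def sum_nonneg)

lemma measurable_sumsq [measurable]: "sumsq K \<in> borel_measurable borel"
  unfolding sumsq_def by (intro borel_measurable_continuous_onI continuous_intros)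

text \<open>Both estimates count dyadic boxes that shrink only in the directions of \<open>K\<close>.\<close>

lemma sumsq_powr_integrable:
  fixes K :: "'n::finite set"
  assumes s: "s < 0" "2 * s > - real (card K)"
  shows "(\<integral>\<^sup>+y. ennreal (sumsq K y powr s) \<partial>ballm) < \<infinity>"
proof -
  \<comment> \<open>In the directions outside K the half-width 2 exceeds the radius of the unit
    ball, so these directions impose no constraint on its points.\<close>
  define D where "D l = box (\<chi> i. 0 - (if i \<in> K then (1/2::real)^l else 1) * 2) (\<chi> i. 0 + (if i \<in> K then (1/2)^l else 1) * 2)" for l :: nat
  have eD: "emeasure lborel (D l :: (real^'n) set) = ennreal (((1/2)^l) ^ card K * (\<Prod>i\<in>(UNIV::'n set). 2 * 2))" for l
    unfolding D_def by (rule emeasure_scaled_box) auto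
  define w where "w l = (4::real) powr (- s * (real l + 1))" for l
  \<comment> \<open>A single term of the series suffices as a majorant. Points with
    \<open>sumsq K y = 0\<close> are harmless because \<open>0 powr s\<close> is 0.\<close>
  have "indicator (cball 0 1) y * ennreal (sumsq K y powr s) \<le> (\<Sum>l. ennreal (w l) * indicator (D l) y)" for y :: "real^'n"
  proof (cases "y \<in> cball 0 1 \<and> sumsq K y \<noteq> 0")
    case True
    define M where "M = Max ((\<lambda>i. \<bar>y $ i\<bar>) ` K)"
    have K: "K \<noteq> {}" using True by (auto simp: sumsq_def)
    have M1: "M \<in> (\<lambda>i. \<bar>y $ i\<bar>) ` K" unfolding M_def using K by (intro Max_in) auto
    have M2: "\<bar>y $ i\<bar> \<le> M" if "i \<in> K" for i unfolding M_def using that by (intro Max_ge) auto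
    have yi: "\<bar>y $ i\<bar> \<le> 1" for i using component_le_norm_cart[of y i] True by simp
    obtain i where i: "i \<in> K" "M = \<bar>y $ i\<bar>" using M1 by auto
    have M3: "M\<^sup>2 \<le> sumsq K y" unfolding sumsq_def i(2) power2_abs
      using i(1) by (intro member_le_sum) auto
    have "M \<noteq> 0"
    proof
      assume "M = 0"
      hence "sumsq K y = 0" using M2 by (force simp: sumsq_def)
      thus False using True by simp
    qed
    hence M0: "M > 0" "M \<le> 1" using i yi by auto
    have "\<exists>l. (1/2)^l < M" using M0(1) by (intro real_arch_pow_inv) auto
    \<comment> \<open>Minimality gives 2^-L < M <= 2^-(L-1). With l = L - 1 the upper bound puts y
      into D l, and the lower bound yields the weight w l, whose exponent contains l + 1 =
      L.\<close>
    define L where "L = (LEAST l. (1/2)^l < M)"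
    have L1: "(1/2)^L < M" unfolding L_def using \<open>\<exists>l. _\<close> by (rule LeastI_ex)
    have "L \<noteq> 0" using L1 M0 by (cases "L = 0") auto
    then obtain l where l: "L = Suc l" by (cases L) auto
    have L2: "M \<le> (1/2)^l" using not_less_Least[of l "\<lambda>l. (1/2)^l < M"] l by (simp add: L_def)
    have "y \<in> D l"
      unfolding D_def mem_box_cart
    proof (intro allI)
      fix i
      have "\<bar>y $ i\<bar> < (if i \<in> K then (1/2)^l else 1) * 2"
      proof (cases "i \<in> K")
        case True
        have "0 < (1/2::real)^l" by simp
        thus ?thesis using M2[OF True] L2 True by (simp del: zero_less_power)
      qed (use yi[of i] in auto)
      thus "(\<chi> i. 0 - (if i \<in> K then (1/2)^l else 1) * 2) $ i < y $ i \<and> y $ i < (\<chi> i. 0 + (if i \<in> K then (1/2)^l else 1) * 2) $ i"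
        unfolding vec_lambda_beta by linarith
    qed
    have "sumsq K y powr s \<le> (M\<^sup>2) powr s"
      using M3 M0 s by (intro powr_mono2') auto
    also have "\<dots> \<le> (((1/2)^L)\<^sup>2) powr s"
      using L1 s by (intro powr_mono2' power_mono) auto
    also have "((1/2::real)^L)\<^sup>2 = 4 powr (- real L)"
      by (simp add: powr_minus powr_realpow power_divide power_mult[symmetric] mult.commute[of L] power_mult divide_simps)
    also have "\<dots> powr s = w l"
      by (simp add: w_def powr_powr l algebra_simps)
    finally have "ennreal (sumsq K y powr s) \<le> ennreal (w l) * indicator (D l) y"
      using \<open>y \<in> D l\<close> by (simp add: ennreal_leI)
    also have "\<dots> = (\<Sum>j\<in>{l}. ennreal (w j) * indicator (D j) y)"
      using sum.insert[of "{}" l "\<lambda>j. ennreal (w j) * indicator (D j) y"]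
      by (simp only: finite.emptyI sum.empty add_0_right empty_iff not_False_eq_True)
    also have "\<dots> \<le> (\<Sum>l. ennreal (w l) * indicator (D l) y)"
      by (rule sum_le_suminf) auto
    finally show ?thesis using True by simp
  qed (auto simp: indicator_def)
  hence "(\<integral>\<^sup>+y. ennreal (sumsq K y powr s) \<partial>ballm) \<le> (\<integral>\<^sup>+y. (\<Sum>l. ennreal (w l) * indicator (D l) y) \<partial>lborel)"
    by (subst nn_integral_ballm) (auto intro!: nn_integral_mono)
  also have "\<dots> = (\<Sum>l. \<integral>\<^sup>+y. ennreal (w l) * indicator (D l) y \<partial>lborel)"
    by (rule nn_integral_suminf) (simp add: D_def)
  also have "\<dots> = (\<Sum>l. ennreal (w l) * emeasure lborel (D l))"
    by (intro suminf_cong nn_integral_cmult_indicator) (simp add: D_def)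
  \<comment> \<open>The weight grows like 2^(-2sl) and the volume decays like 2^(-kl), k being the
    cardinality of K. The hypothesis on s says precisely that the quotient of this geometric series
    is below 1.\<close>
  also have "\<dots> = (\<Sum>l. ennreal ((4 powr (-s) * 4 ^ CARD('n)) * (2 powr (- 2 * s - real (card K))) ^ l))"
  proof (intro suminf_cong)
    fix l
    have "w l = 4 powr (-s) * (2 powr (- 2 * s)) ^ l"
    proof -
      have "(4::real) powr x = 2 powr (2 * x)" for x
        using powr_powr[of 2 2 x] by simp
      thus ?thesis by (simp add: w_def powr_power powr_add[symmetric] algebra_simps)
    qed
    moreover have "(2 powr (- 2 * s - real (card K))) = 2 powr (- 2 * s) * (1/2) ^ card K"
      by (simp add: powr_diff powr_realpow power_divide)
    ultimately have "w l * (((1/2)^l) ^ card K * 4 ^ CARD('n)) = (4 powr (-s) * 4 ^ CARD('n)) * (2 powr (- 2 * s - real (card K))) ^ l"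
      by (simp add: power_mult_distrib power_mult[symmetric] mult.commute[of l])
    thus "ennreal (w l) * emeasure lborel (D l) = ennreal ((4 powr (-s) * 4 ^ CARD('n)) * (2 powr (- 2 * s - real (card K))) ^ l)"
      by (simp add: eD ennreal_mult[symmetric] w_def)
  qed
  also have "\<dots> < \<infinity>"
  proof -
    have "2 powr (- 2 * s - real (card K)) < (1::real)" using s by (simp add: powr_less_one)
    hence "summable (\<lambda>l. (4 powr (-s) * 4 ^ CARD('n)) * (2 powr (- 2 * s - real (card K))) ^ l)"
      by (intro summable_mult summable_geometric) simp
    thus ?thesis by (subst suminf_ennreal2) auto
  qed
  finally show ?thesis .
qed

text \<open>At the critical exponent every dyadic shell has volume of order 2^(-lk) and integrand at
  least of order 2^(lk), so all shells contribute at least the same positive constant. The box may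
  be centred anywhere in the directions outside K; this freedom later keeps a denominator away from
  0.\<close>

lemma sumsq_powr_not_integrable:
  fixes K :: "'n::finite set"
  assumes K: "K \<noteq> {}" and s: "\<And>i. s i > 0"
  shows "(\<integral>\<^sup>+y\<in>box (\<chi> i. (if i \<in> K then 0 else p i) - s i) (\<chi> i. (if i \<in> K then 0 else p i) + s i).
     ennreal (sumsq K y powr (- real (card K) / 2)) \<partial>lborel) = \<infinity>"
proof -
  let ?p = "\<lambda>i. if i \<in> K then 0 else p i"
  define k where "k = card K"
  have k: "k > 0" using K by (simp add: k_def card_gt_0_iff)
  define D where "D l = box (\<chi> i. ?p i - (if i \<in> K then (1/2::real)^l else 1) * s i) (\<chi> i. ?p i + (if i \<in> K then (1/2)^l else 1) * s i)" for l :: nat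
  have eD: "emeasure lborel (D l) = ennreal (((1/2)^l) ^ k * (\<Prod>i\<in>UNIV. 2 * s i))" for l
    unfolding D_def k_def by (rule emeasure_scaled_box) (auto intro: less_imp_le[OF s])
  have D_iff: "y \<in> D l \<longleftrightarrow> (\<forall>i. \<bar>y $ i - ?p i\<bar> < (if i \<in> K then (1/2)^l else 1) * s i)" for y l
    unfolding D_def mem_box_cart by (auto simp: abs_less_iff) (smt (verit))+
  have D0: "D 0 = box (\<chi> i. ?p i - s i) (\<chi> i. ?p i + s i)" by (simp add: D_def cong: if_cong)
  have mono: "D l' \<subseteq> D l" if "l \<le> l'" for l l'
  proof
    fix y assume y: "y \<in> D l'"
    have "(1/2)^l' * s i \<le> (1/2)^l * s i" for i
      using that s[of i] by (intro mult_right_mono power_decreasing) auto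
    thus "y \<in> D l" using y unfolding D_iff by (smt (verit))
  qed
  define E where "E l = D l - D (Suc l)" for l
  have [measurable]: "D l \<in> sets borel" "E l \<in> sets borel" for l by (auto simp: D_def E_def)
  have disj: "disjoint_family E"
    unfolding disjoint_family_on_def
  proof (intro ballI impI)
    fix m n :: nat assume "m \<noteq> n"
    thus "E m \<inter> E n = {}"
      using mono[of "Suc m" n] mono[of "Suc n" m] by (auto simp: E_def) (metis Suc_leI linorder_neqE_nat subsetD)+
  qed
  define P where "P = (\<Prod>i\<in>UNIV. 2 * s i)"
  have P: "P > 0" unfolding P_def using s by (intro prod_pos) auto
  define R where "R = (\<Sum>i\<in>K. (s i)\<^sup>2)"
  have R: "R > 0" unfolding R_def using K s by (intro sum_pos) (auto simp: less_imp_neq[symmetric])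
  define c where "c = R powr (- real k / 2) * (P * (1 - (1/2)^k))"
  have "(1/2::real)^k < 1" using power_strict_decreasing[of 0 k "1/2::real"] k by simp
  hence c: "c > 0" unfolding c_def using P R by simp
  have eE: "emeasure lborel (E l) = ennreal (((1/2)^l)^k * (P * (1 - (1/2)^k)))" for l
  proof -
    have "emeasure lborel (E l) = emeasure lborel (D l) - emeasure lborel (D (Suc l))"
      unfolding E_def by (rule emeasure_Diff) (use mono[of l "Suc l"] eD in auto)
    also have "\<dots> = ennreal (((1/2)^l)^k * P - ((1/2)^Suc l)^k * P)"
      unfolding eD P_def[symmetric] using P by (simp add: ennreal_minus)
    also have "((1/2)^l)^k * P - ((1/2)^Suc l)^k * P = ((1/2)^l)^k * (P * (1 - (1/2)^k))"
      unfolding power_Suc power_mult_distrib[of "1/2"] by algebra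
    finally show ?thesis .
  qed
  have bound: "ennreal c \<le> (\<integral>\<^sup>+y\<in>E l. ennreal (sumsq K y powr (- real k / 2)) \<partial>lborel)" for l
  proof -
    have "sumsq K y powr (- real k / 2) \<ge> R powr (- real k / 2) * (2^l)^k" if "y \<in> E l" for y
    proof -
      have y: "y \<in> D l" "y \<notin> D (Suc l)" using that by (auto simp: E_def)
      obtain i where i: "\<not> \<bar>y $ i - ?p i\<bar> < (if i \<in> K then (1/2)^Suc l else 1) * s i"
        using y(2) unfolding D_iff by blast
      \<comment> \<open>Outside K the conditions for D l and D (Suc l) coincide, so leaving the
        smaller box must happen in a direction of K.\<close>
      have "i \<in> K" using i y(1) unfolding D_iff by (metis (full_types))
      moreover have "(1/2)^Suc l * s i > 0" using s[of i] by simp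
      ultimately have "y $ i \<noteq> 0" using i by auto
      hence "sumsq K y > 0" unfolding sumsq_def using \<open>i \<in> K\<close>
        by (intro sum_pos2[of _ i]) auto
      moreover have "sumsq K y \<le> ((1/2)^l)\<^sup>2 * R"
        unfolding sumsq_def R_def sum_distrib_left
      proof (rule sum_mono)
        fix i assume "i \<in> K"
        hence "\<bar>y $ i\<bar> \<le> (1/2)^l * s i" using y(1) unfolding D_iff by (smt (verit))
        hence "\<bar>y $ i\<bar>\<^sup>2 \<le> ((1/2)^l * s i)\<^sup>2" by (intro power_mono) auto
        thus "(y $ i)\<^sup>2 \<le> ((1/2)^l)\<^sup>2 * (s i)\<^sup>2" by (simp add: power_mult_distrib)
      qed
      ultimately have "sumsq K y powr (- real k / 2) \<ge> (((1/2)^l)\<^sup>2 * R) powr (- real k / 2)"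
        by (intro powr_mono2') auto
      also have "(((1/2)^l)\<^sup>2 * R) powr (- real k / 2) = R powr (- real k / 2) * (2^l)^k"
      proof -
        have "((1/2::real)^l)\<^sup>2 = 2 powr (- 2 * real l)"
          by (simp add: mult.commute powr_minus powr_realpow[symmetric] power_divide divide_simps powr_powr powr_add[symmetric])
        hence "(((1/2::real)^l)\<^sup>2) powr (- real k / 2) = 2 powr (real l * real k)"
          by (simp add: powr_powr)
        also have "\<dots> = (2^l)^k"
          by (simp add: powr_realpow[symmetric] powr_powr)
        finally show ?thesis using R by (simp add: powr_mult)
      qed
      finally show ?thesis .
    qed
    hence "(\<integral>\<^sup>+y. ennreal (R powr (- real k / 2) * (2^l)^k) * indicator (E l) y \<partial>lborel)
        \<le> (\<integral>\<^sup>+y\<in>E l. ennreal (sumsq K y powr (- real k / 2)) \<partial>lborel)"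
      by (intro nn_integral_mono) (auto simp: indicator_def intro: ennreal_leI)
    moreover have "(\<integral>\<^sup>+y. ennreal (R powr (- real k / 2) * (2^l)^k) * indicator (E l) y \<partial>lborel) = ennreal c"
    proof -
      have "R powr (- real k / 2) * (2^l)^k * (((1/2)^l)^k * (P * (1 - (1/2)^k))) = c"
        unfolding c_def by (simp add: power_divide)
      thus ?thesis using R by (simp add: nn_integral_cmult_indicator eE ennreal_mult'[symmetric])
    qed
    ultimately show ?thesis by simp
  qed
  have "(\<Sum>l. ennreal c) \<le> (\<Sum>l. \<integral>\<^sup>+y\<in>E l. ennreal (sumsq K y powr (- real k / 2)) \<partial>lborel)"
    using bound by (intro suminf_le) auto
  also have "\<dots> = (\<integral>\<^sup>+y\<in>(\<Union>l. E l). ennreal (sumsq K y powr (- real k / 2)) \<partial>lborel)"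
    by (rule nn_integral_disjoint_family[symmetric, OF _ _ disj]) auto
  also have "\<dots> \<le> (\<integral>\<^sup>+y\<in>D 0. ennreal (sumsq K y powr (- real k / 2)) \<partial>lborel)"
    using mono[of 0] by (intro nn_integral_mono mult_left_mono) (auto simp: E_def indicator_def)
  finally have "(\<Sum>l. ennreal c) \<le> (\<integral>\<^sup>+y\<in>D 0. ennreal (sumsq K y powr (- real k / 2)) \<partial>lborel)" .
  moreover have "(\<Sum>l::nat. ennreal c) = \<infinity>"
    using c by (simp add: suminf_eq_SUP SUP_mult_right_ennreal[symmetric] ennreal_SUP_of_nat_eq_top ennreal_top_mult)
  ultimately show ?thesis unfolding D0 k_def by (simp add: top_unique)
qed

lemma ballm_orthogonal:
  fixes g :: "real^'n^'n"
  assumes g: "orthogonal_matrix g" and f[measurable]: "f \<in> borel_measurable borel"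
  shows "(\<integral>\<^sup>+y. f (g *v y) \<partial>ballm) = (\<integral>\<^sup>+y. f y \<partial>ballm)"
proof -
  have o: "orthogonal_transformation ((*v) g)" using g
    by (simp add: orthogonal_transformation_matrix)
  have [measurable]: "(*v) g \<in> borel_measurable borel"
    by (intro borel_measurable_continuous_onI matrix_vector_mult_linear_continuous_on)
  have [measurable]: "cball (0::real^'n) 1 \<in> sets borel" by simp
  have "(\<integral>\<^sup>+y. f y \<partial>ballm) = (\<integral>\<^sup>+y. indicator (cball 0 1) y * f y \<partial>lborel)"
    by (rule nn_integral_ballm) simp
  also have "\<dots> = (\<integral>\<^sup>+y. indicator (cball 0 1) y * f y \<partial>distr lborel borel ((*v) g))"
    by (simp add: distr_lborel_orthogonal[OF o])
  also have "\<dots> = (\<integral>\<^sup>+y. indicator (cball 0 1) (g *v y) * f (g *v y) \<partial>lborel)"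
    by (rule nn_integral_distr) measurable
  also have "\<dots> = (\<integral>\<^sup>+y. indicator (cball 0 1) y * f (g *v y) \<partial>lborel)"
    using o by (simp add: indicator_def orthogonal_transformation)
  also have "\<dots> = (\<integral>\<^sup>+y. f (g *v y) \<partial>ballm)"
    by (rule nn_integral_ballm[symmetric]) simp
  finally show ?thesis ..
qed

text \<open>The function \<beta> stands for the squared distance to the span of the earlier columns,
  and the constants are fixed before it. On the ball \<beta> <= 1, so the ratio lies between
  \<open>sumsq K y\<close> and 1, which gives the upper bounds. The coordinate i0 outside K bounds
  \<beta> from below where \<open>sumsq K y\<close> tends to 0, which gives divergence.\<close>

lemma sumsq_ratio_bounds:
  fixes K :: "'n::finite set" and mu :: real
  assumes i1: "i1 \<in> K" and i0: "i0 \<notin> K"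
  obtains c C :: ennreal where "0 < c" "mu > - real (card K) \<Longrightarrow> C < \<infinity>" "mu \<le> - real (card K) \<Longrightarrow> c = \<infinity>"
    "\<And>\<beta>. \<beta> \<in> borel_measurable borel \<Longrightarrow>
       (\<And>y. sumsq K y \<le> \<beta> y) \<Longrightarrow> (\<And>y. \<beta> y \<le> (norm y)\<^sup>2) \<Longrightarrow> (\<And>y. (y $ i0)\<^sup>2 \<le> \<beta> y) \<Longrightarrow>
       c \<le> (\<integral>\<^sup>+y. ennreal ((sumsq K y / \<beta> y) powr (mu / 2)) \<partial>ballm) \<and>
       (\<integral>\<^sup>+y. ennreal ((sumsq K y / \<beta> y) powr (mu / 2)) \<partial>ballm) \<le> C"
proof -
  have [measurable]: "cball (0::real^'n) 1 \<in> sets borel" by simp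
  define k where "k = card K"
  have k: "k > 0" using i1 by (auto simp: k_def card_gt_0_iff)
  define C where "C = (if mu \<ge> 0 then emeasure ballm (UNIV :: (real^'n) set) else (\<integral>\<^sup>+y. ennreal (sumsq K y powr (mu / 2)) \<partial>ballm))"
  \<comment> \<open>The ball of radius 1/4 around p lies in the unit ball and has y_i1 >= 1/2, hence
    \<open>sumsq K y\<close> >= 1/4 and the ratio is at least 1/4 there. In the constant c, the
    value 1 of the minimum serves negative mu, where a ratio <= 1 has power >= 1.\<close>
  define p :: "real^'n" where "p = (3/4) *\<^sub>R axis i1 1"
  define c where "c = (if mu > - real k then ennreal (min 1 ((1/4) powr (mu / 2))) * emeasure lborel (ball p (1/4)) else \<infinity>)"
  show ?thesis
  proof (rule that[of c C])
    have "0 < measure lborel (ball p (1/4))" by (rule content_ball_pos) simp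
    hence "emeasure lborel (ball p (1/4)) \<noteq> 0" by (metis enn2real_0 less_irrefl measure_def)
    hence "emeasure lborel (ball p (1/4)) > 0" by (simp add: zero_less_iff_neq_zero)
    thus "0 < c" unfolding c_def by (auto simp: ennreal_zero_less_mult_iff)
    show "C < \<infinity>" if "mu > - real (card K)"
    proof (cases "mu \<ge> 0")
      case True
      thus ?thesis using finite_measure.emeasure_finite[OF finite_measure_ballm, of "UNIV :: (real^'n) set"]
        by (simp add: C_def less_top)
    next
      case False
      thus ?thesis using sumsq_powr_integrable[of "mu/2" K] that by (simp add: C_def)
    qed
    show "c = \<infinity>" if "mu \<le> - real (card K)" using that by (simp add: c_def k_def)
  next
    fix \<beta> :: "real^'n \<Rightarrow> real"
    assume [measurable]: "\<beta> \<in> borel_measurable borel"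
      and b1: "\<And>y. sumsq K y \<le> \<beta> y" and b2: "\<And>y. \<beta> y \<le> (norm y)\<^sup>2" and b3: "\<And>y. (y $ i0)\<^sup>2 \<le> \<beta> y"
    let ?r = "\<lambda>y. sumsq K y / \<beta> y"
    have r0: "0 \<le> ?r y" for y using sumsq_nonneg[of K y] b1[of y] by simp
    have r1: "?r y \<le> 1" for y using sumsq_nonneg[of K y] b1[of y] by (auto simp: divide_le_eq_1)
    have bc: "\<beta> y \<le> 1" if "y \<in> cball 0 1" for y
    proof -
      have "(norm y)\<^sup>2 \<le> 1" using that power_mono[of "norm y" 1 2] by simp
      thus ?thesis using b2[of y] by simp
    qed
    have I: "(\<integral>\<^sup>+y. ennreal (?r y powr (mu / 2)) \<partial>ballm) = (\<integral>\<^sup>+y. indicator (cball 0 1) y * ennreal (?r y powr (mu / 2)) \<partial>lborel)"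
      by (rule nn_integral_ballm) simp
    have "(\<integral>\<^sup>+y. ennreal (?r y powr (mu / 2)) \<partial>ballm) \<le> C"
    proof (cases "mu \<ge> 0")
      case True
      have "(\<integral>\<^sup>+y. ennreal (?r y powr (mu / 2)) \<partial>ballm) \<le> (\<integral>\<^sup>+(y::real^'n). 1 \<partial>ballm)"
      proof (intro nn_integral_mono)
        fix y
        have "?r y powr (mu / 2) \<le> 1" using True powr_mono2[of "mu/2" "?r y" 1, OF _ r0 r1] by simp
        thus "ennreal (?r y powr (mu / 2)) \<le> 1" by simp
      qed
      thus ?thesis using True by (simp add: C_def)
    next
      case False
      have "indicator (cball 0 1) y * ennreal (?r y powr (mu / 2)) \<le> indicator (cball 0 1) y * ennreal (sumsq K y powr (mu / 2))" for y
      proof (cases "y \<in> cball 0 1 \<and> sumsq K y \<noteq> 0")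
        case True
        hence "sumsq K y > 0" using sumsq_nonneg[of K y] by simp
        moreover from this have "sumsq K y \<le> ?r y" using bc[of y] b1[of y] True
          by (simp add: le_divide_eq mult_left_le)
        ultimately have "?r y powr (mu / 2) \<le> sumsq K y powr (mu / 2)"
          using False by (intro powr_mono2') auto
        thus ?thesis by (intro mult_left_mono ennreal_leI) auto
      qed (auto simp: indicator_def)
      thus ?thesis unfolding I using False
        by (simp add: C_def nn_integral_ballm nn_integral_mono)
    qed
    moreover have "c \<le> (\<integral>\<^sup>+y. ennreal (?r y powr (mu / 2)) \<partial>ballm)"
    proof (cases "mu > - real k")
      case True
      have "ennreal (min 1 ((1/4) powr (mu / 2))) * indicator (ball p (1/4)) y \<le> indicator (cball 0 1) y * ennreal (?r y powr (mu / 2))" for y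
      proof (cases "y \<in> ball p (1/4)")
        case y: True
        have np: "norm p = 3/4" by (simp add: p_def)
        have "norm y \<le> norm p + norm (y - p)" by (metis add.commute diff_add_cancel norm_triangle_ineq)
        hence y1: "y \<in> cball 0 1" using y np by (simp add: dist_norm norm_minus_commute)
        have "\<bar>(y - p) $ i1\<bar> \<le> norm (y - p)" by (rule component_le_norm_cart)
        hence "y $ i1 \<ge> 1/2" using y by (simp add: p_def dist_norm norm_minus_commute)
        hence "(1/2)\<^sup>2 \<le> (y $ i1)\<^sup>2" by (intro power_mono) auto
        also have "\<dots> \<le> sumsq K y" unfolding sumsq_def using i1 by (intro member_le_sum) auto
        finally have s: "1/4 \<le> sumsq K y" by (simp add: power2_eq_square)
        have r: "1/4 \<le> ?r y" using s bc[OF y1] b1[of y] by (simp add: le_divide_eq)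
        have "min 1 ((1/4) powr (mu / 2)) \<le> ?r y powr (mu / 2)"
        proof (cases "mu \<ge> 0")
          case True
          thus ?thesis using powr_mono2[of "mu/2" "1/4" "?r y"] r by simp
        next
          case False
          thus ?thesis using powr_mono2'[of "mu/2" "?r y" 1] r r1[of y] by simp
        qed
        thus ?thesis using y y1 by (simp add: ennreal_leI)
      qed simp
      hence "(\<integral>\<^sup>+y. ennreal (min 1 ((1/4) powr (mu / 2))) * indicator (ball p (1/4)) y \<partial>lborel) \<le> (\<integral>\<^sup>+y. indicator (cball 0 1) y * ennreal (?r y powr (mu / 2)) \<partial>lborel)"
        by (intro nn_integral_mono)
      thus ?thesis unfolding I using True by (simp add: c_def nn_integral_cmult_indicator)
    next
      case False
      hence mu: "mu / 2 \<le> - real k / 2" by simp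
      \<comment> \<open>With this d the coordinates other than i0 add at most 1/2 to the l1 norm.
        The coordinate i0 lies between 1/4 and 1/2, so the box stays inside the unit ball and
        \<beta> >= 1/16 on it.\<close>
      define d where "d = 1 / (2 * real CARD('n))"
      have d: "d > 0" by (simp add: d_def)
      define s where "s i = (if i = i0 then 1/8 else d)" for i
      define q where "q i = (if i = i0 then 3/8 else (0::real))" for i
      define D where "D = box (\<chi> i. (if i \<in> K then 0 else q i) - s i) (\<chi> i. (if i \<in> K then 0 else q i) + s i)"
      have [measurable]: "D \<in> sets borel" by (simp add: D_def)
      have inf: "(\<integral>\<^sup>+y\<in>D. ennreal (sumsq K y powr (- real (card K) / 2)) \<partial>lborel) = \<infinity>"
        unfolding D_def by (rule sumsq_powr_not_integrable) (use i1 d in \<open>auto simp: s_def\<close>)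
      have "ennreal (16 powr (- real k / 2)) * (ennreal (sumsq K y powr (- real k / 2)) * indicator D y) \<le> indicator (cball 0 1) y * ennreal (?r y powr (mu / 2))" for y
      proof (cases "y \<in> D \<and> sumsq K y \<noteq> 0")
        case y: True
        have yi0: "1/4 < y $ i0" "y $ i0 < 1/2"
          using y i0 spec[of "\<lambda>i. (if i \<in> K then 0 else q i) - s i < y $ i \<and> y $ i < (if i \<in> K then 0 else q i) + s i" i0]
          by (auto simp: D_def mem_box_cart q_def s_def)
        have yi: "\<bar>y $ i\<bar> \<le> d" if "i \<noteq> i0" for i
          using y that spec[of "\<lambda>i. (if i \<in> K then 0 else q i) - s i < y $ i \<and> y $ i < (if i \<in> K then 0 else q i) + s i" i]
          by (auto simp: D_def mem_box_cart q_def s_def split: if_splits)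
        have "norm y \<le> (\<Sum>i\<in>UNIV. \<bar>y $ i\<bar>)" by (rule norm_le_l1_cart)
        also have "\<dots> \<le> (\<Sum>i\<in>UNIV. (if i = i0 then 1/2 else 0) + d)"
          using yi yi0 d by (intro sum_mono) auto
        also have "\<dots> = 1" by (simp add: sum.distrib d_def)
        finally have y1: "y \<in> cball 0 1" by simp
        have s0: "sumsq K y > 0" using y sumsq_nonneg[of K y] by simp
        have "(1/4)\<^sup>2 \<le> (y $ i0)\<^sup>2" using yi0 by (intro power_mono) auto
        hence "1/16 \<le> \<beta> y" using b3[of y] by (simp add: power2_eq_square)
        hence r16: "?r y \<le> 16 * sumsq K y" using s0 by (simp add: divide_le_eq)
        have rp: "?r y > 0" using s0 b1[of y] by simp
        have "16 powr (- real k / 2) * sumsq K y powr (- real k / 2) = (16 * sumsq K y) powr (- real k / 2)"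
          using s0 by (simp add: powr_mult)
        also have "\<dots> \<le> ?r y powr (- real k / 2)"
          using r16 rp by (intro powr_mono2') auto
        \<comment> \<open>As the ratio is at most 1, lowering the exponent from -k/2 to mu/2 only
          increases the power; divergence at the critical exponent covers all smaller ones.\<close>
        also have "\<dots> \<le> ?r y powr (mu / 2)"
          using mu rp r1[of y] by (intro powr_mono') auto
        finally show ?thesis using y y1 by (simp add: ennreal_mult[symmetric] ennreal_leI)
      qed (auto simp: indicator_def)
      hence "(\<integral>\<^sup>+y. ennreal (16 powr (- real k / 2)) * (ennreal (sumsq K y powr (- real k / 2)) * indicator D y) \<partial>lborel) \<le> (\<integral>\<^sup>+y. indicator (cball 0 1) y * ennreal (?r y powr (mu / 2)) \<partial>lborel)"
        by (intro nn_integral_mono)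
      also have "(\<integral>\<^sup>+y. ennreal (16 powr (- real k / 2)) * (ennreal (sumsq K y powr (- real k / 2)) * indicator D y) \<partial>lborel) = \<infinity>"
        using inf by (subst nn_integral_cmult) (simp_all add: k_def ennreal_mult_top)
      finally show ?thesis unfolding I by (simp add: top_unique)
    qed
    ultimately show "c \<le> (\<integral>\<^sup>+y. ennreal ((sumsq K y / \<beta> y) powr (mu / 2)) \<partial>ballm) \<and>
       (\<integral>\<^sup>+y. ennreal ((sumsq K y / \<beta> y) powr (mu / 2)) \<partial>ballm) \<le> C" by simp
  qed
qed

text \<open>A rotation takes coordinate axes to S together with b, and \<open>ballm\<close> is
  invariant under it. The coordinate set K and the index i0 are chosen once from k alone, so the
  constants are the same for all S, b and \<beta>.\<close>

lemma projection_ratio_bounds: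
  fixes mu :: real
  assumes k: "1 \<le> k" "k < CARD('n::finite)"
  obtains c C :: ennreal where "0 < c" "mu > - real k \<Longrightarrow> C < \<infinity>" "mu \<le> - real k \<Longrightarrow> c = \<infinity>"
    "\<And>(S :: (real^'n) set) b \<beta>. card S = k \<Longrightarrow>
       (\<And>x y. x \<in> S \<Longrightarrow> y \<in> S \<Longrightarrow> x \<bullet> y = (if x = y then 1 else 0)) \<Longrightarrow>
       (\<And>x. x \<in> S \<Longrightarrow> x \<bullet> b = 0) \<Longrightarrow> norm b = 1 \<Longrightarrow> \<beta> \<in> borel_measurable borel \<Longrightarrow>
       (\<And>y. (\<Sum>x\<in>S. (x \<bullet> y)\<^sup>2) \<le> \<beta> y) \<Longrightarrow> (\<And>y. \<beta> y \<le> (norm y)\<^sup>2) \<Longrightarrow> (\<And>y. (b \<bullet> y)\<^sup>2 \<le> \<beta> y) \<Longrightarrow>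
       c \<le> (\<integral>\<^sup>+y. ennreal (((\<Sum>x\<in>S. (x \<bullet> y)\<^sup>2) / \<beta> y) powr (mu / 2)) \<partial>ballm) \<and>
       (\<integral>\<^sup>+y. ennreal (((\<Sum>x\<in>S. (x \<bullet> y)\<^sup>2) / \<beta> y) powr (mu / 2)) \<partial>ballm) \<le> C"
proof -
  obtain K :: "'n set" where K: "card K = k"
    using obtain_subset_with_card_n[of k "UNIV :: 'n set"] k by auto
  obtain i1 where i1: "i1 \<in> K" using K k by (metis card.empty ex_in_conv not_one_le_zero)
  obtain i0 where i0: "i0 \<notin> K" using K k by (metis UNIV_eq_I less_irrefl)
  show ?thesis
  proof (rule sumsq_ratio_bounds[OF i1 i0, where mu = mu], goal_cases)
    case (1 c C)
    note cC = this
  show ?thesis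
  proof (rule that[OF cC(1)])
    fix S :: "(real^'n) set" and b and \<beta> :: "real^'n \<Rightarrow> real"
    assume S: "card S = k" and on: "\<And>x y. x \<in> S \<Longrightarrow> y \<in> S \<Longrightarrow> x \<bullet> y = (if x = y then 1 else 0)"
      and b: "\<And>x. x \<in> S \<Longrightarrow> x \<bullet> b = 0" "norm b = 1" and [measurable]: "\<beta> \<in> borel_measurable borel"
      and h: "\<And>y. (\<Sum>x\<in>S. (x \<bullet> y)\<^sup>2) \<le> \<beta> y" "\<And>y. \<beta> y \<le> (norm y)\<^sup>2" "\<And>y. (b \<bullet> y)\<^sup>2 \<le> \<beta> y"
    have "finite S" using S k by (metis card.infinite not_one_le_zero)
    then obtain e where e: "bij_betw e K S"
      using finite_same_card_bij[of K S] S K by auto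
    define a where "a i = (if i \<in> K then e i else b)" for i
    have eS: "e i \<in> S" if "i \<in> K" for i using e that by (auto simp: bij_betw_def)
    have aK: "a i \<bullet> a j = (if i = j then 1 else 0)" if "i \<in> K" "j \<in> K" for i j
    proof -
      have "e i = e j \<longleftrightarrow> i = j" using e that by (auto simp: bij_betw_def inj_on_def)
      thus ?thesis using on[OF eS eS, OF that] that by (simp add: a_def)
    qed
    have "a i \<bullet> a i0 = 0" "a i0 \<bullet> a i = 0" if "i \<in> K" for i
      using b(1)[OF eS[OF that]] that i0 by (simp_all add: a_def inner_commute)
    moreover have "a i0 \<bullet> a i0 = 1" using b(2) i0 by (simp add: a_def norm_eq_1)
    ultimately have "a i \<bullet> a j = (if i = j then 1 else 0)" if "i \<in> insert i0 K" "j \<in> insert i0 K" for i j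
      using that i0 aK by (cases "i = i0"; cases "j = i0") auto
    then obtain g :: "real^'n^'n" where g: "orthogonal_matrix g" "\<And>i. i \<in> insert i0 K \<Longrightarrow> g *v axis i 1 = a i"
      using orthonormal_extend[of "insert i0 K" a] by blast
    have o: "orthogonal_transformation ((*v) g)" using g(1)
      by (simp add: orthogonal_transformation_matrix)
    have ag: "a i \<bullet> (g *v y) = y $ i" if "i \<in> insert i0 K" for i y
      using o g(2)[OF that, symmetric] by (simp add: orthogonal_transformation_def inner_axis' )
    have sg: "(\<Sum>x\<in>S. (x \<bullet> (g *v y))\<^sup>2) = sumsq K y" for y
    proof -
      have "(\<Sum>x\<in>S. (x \<bullet> (g *v y))\<^sup>2) = (\<Sum>i\<in>K. (e i \<bullet> (g *v y))\<^sup>2)"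
        by (rule sum.reindex_bij_betw[OF e, symmetric])
      also have "\<dots> = sumsq K y" unfolding sumsq_def
        by (intro sum.cong refl) (use ag in \<open>force simp: a_def\<close>)
      finally show ?thesis .
    qed
    have [measurable]: "(*v) g \<in> borel_measurable borel"
      by (intro borel_measurable_continuous_onI matrix_vector_mult_linear_continuous_on)
    have [measurable]: "(\<lambda>y. \<Sum>x\<in>S. (x \<bullet> y)\<^sup>2) \<in> borel_measurable borel"
      by (intro borel_measurable_continuous_onI continuous_intros)
    have "(\<integral>\<^sup>+y. ennreal (((\<Sum>x\<in>S. (x \<bullet> y)\<^sup>2) / \<beta> y) powr (mu / 2)) \<partial>ballm)
      = (\<integral>\<^sup>+y. ennreal (((\<Sum>x\<in>S. (x \<bullet> (g *v y))\<^sup>2) / \<beta> (g *v y)) powr (mu / 2)) \<partial>ballm)"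
      by (rule ballm_orthogonal[OF g(1), symmetric]) measurable
    also have "\<dots> = (\<integral>\<^sup>+y. ennreal ((sumsq K y / \<beta> (g *v y)) powr (mu / 2)) \<partial>ballm)"
      by (simp only: sg)
    finally have eq: "(\<integral>\<^sup>+y. ennreal (((\<Sum>x\<in>S. (x \<bullet> y)\<^sup>2) / \<beta> y) powr (mu / 2)) \<partial>ballm)
      = (\<integral>\<^sup>+y. ennreal ((sumsq K y / \<beta> (g *v y)) powr (mu / 2)) \<partial>ballm)" .
    show "c \<le> (\<integral>\<^sup>+y. ennreal (((\<Sum>x\<in>S. (x \<bullet> y)\<^sup>2) / \<beta> y) powr (mu / 2)) \<partial>ballm) \<and>
       (\<integral>\<^sup>+y. ennreal (((\<Sum>x\<in>S. (x \<bullet> y)\<^sup>2) / \<beta> y) powr (mu / 2)) \<partial>ballm) \<le> C"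
      unfolding eq
    proof (rule cC(4))
      show "sumsq K y \<le> \<beta> (g *v y)" for y using h(1)[of "g *v y"] by (simp add: sg)
      show "\<beta> (g *v y) \<le> (norm y)\<^sup>2" for y
        using h(2)[of "g *v y"] o by (simp add: orthogonal_transformation)
      have "a i0 = b" using i0 by (simp add: a_def)
      thus "(y $ i0)\<^sup>2 \<le> \<beta> (g *v y)" for y
        using h(3)[of "g *v y"] ag[of i0 y] by simp
    qed measurable
  qed (use cC(2,3) K in auto)
  qed
qed

section \<open>Independent columns in the unit ball\<close>

lemma borel_measurable_gram:
  fixes f :: "'m::finite \<Rightarrow> 'b \<Rightarrow> 'a::euclidean_space"
  assumes "\<And>i. i \<in> S \<Longrightarrow> f i \<in> borel_measurable N"
  shows "(\<lambda>x. gram (\<lambda>i. f i x) S) \<in> borel_measurable N"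
  unfolding gram_def principal_minor_def vec_lambda_beta
proof (intro borel_measurable_sum borel_measurable_times borel_measurable_const borel_measurable_prod)
  fix p k assume "p \<in> {p. p permutes S}" "k \<in> S"
  moreover from this have "p k \<in> S" using permutes_in_image by fastforce
  ultimately show "(\<lambda>x. f k x \<bullet> f (p k) x) \<in> borel_measurable N"
    using assms by (intro borel_measurable_inner)
qed

lemma borel_measurable_rho:
  fixes f :: "'m::{finite,linorder} \<Rightarrow> 'b \<Rightarrow> 'a::euclidean_space"
  assumes "\<And>i. i \<le> j \<Longrightarrow> f i \<in> borel_measurable N"
  shows "(\<lambda>x. rho (\<lambda>i. f i x) j) \<in> borel_measurable N"
  unfolding rho_def using assms
  by (intro borel_measurable_divide borel_measurable_gram) auto

lemma inner_transpose_mult: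
  fixes v :: "real^'m^'n"
  shows "b \<bullet> (transpose v *v y) = (v *v b) \<bullet> y"
  by (simp add: inner_commute[of b] inner_commute[of _ y] dot_lmul_matrix)

lemma stiefel_inner:
  fixes v :: "real^'m^'n"
  assumes "v \<in> stiefel"
  shows "(v *v a) \<bullet> (v *v b) = a \<bullet> b"
  using assms unfolding inner_transpose_mult[symmetric] matrix_vector_mul_assoc
  by (simp add: stiefel_def)

lemma stiefel_norm_le:
  fixes v :: "real^'m^'n"
  assumes "v \<in> stiefel"
  shows "norm (transpose v *v y) \<le> norm y"
proof -
  let ?p = "transpose v *v y"
  have "(norm ?p)\<^sup>2 = (v *v ?p) \<bullet> y"
    unfolding power2_norm_eq_inner by (rule inner_transpose_mult)
  also have "\<dots> \<le> norm (v *v ?p) * norm y" by (rule norm_cauchy_schwarz)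
  also have "norm (v *v ?p) = norm ?p"
    by (simp add: norm_eq_sqrt_inner stiefel_inner[OF assms])
  finally show ?thesis by (cases "norm ?p = 0") (auto simp: power2_eq_square)
qed

lemma orthonormal_sum_sq:
  fixes B :: "'a::euclidean_space set"
  assumes "pairwise orthogonal B" "\<And>b. b \<in> B \<Longrightarrow> norm b = 1" "finite B" "r \<in> span B"
  shows "(\<Sum>b\<in>B. (b \<bullet> r)\<^sup>2) = (norm r)\<^sup>2"
proof -
  have e: "(\<Sum>b\<in>B. (b \<bullet> r) *\<^sub>R b) = r"
    using orthonormal_basis_expand[OF assms(1,2,4,3)] by (simp add: inner_commute)
  have "(norm r)\<^sup>2 = r \<bullet> (\<Sum>b\<in>B. (b \<bullet> r) *\<^sub>R b)" by (simp only: e power2_norm_eq_inner)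
  also have "\<dots> = (\<Sum>b\<in>B. (b \<bullet> r)\<^sup>2)"
    by (simp add: inner_sum_right power2_eq_square inner_commute)
  finally show ?thesis ..
qed

text \<open>As a function of the j-th column y, the numerator is the squared length of the
  projection of v'y onto the complement of the earlier v'x_i, and the denominator is the squared
  distance from y to the span of the earlier x_i. This matches the hypotheses of the projection
  bounds.\<close>

lemma rho_ratio_as_projection:
  fixes v :: "real^('m::{finite,linorder})^'n" and x :: "'m \<Rightarrow> real^'n"
  assumes v: "v \<in> stiefel" and mn: "CARD('m) < CARD('n)"
    and g: "gram (\<lambda>i. transpose v *v x i) {..<j} \<noteq> 0"
  obtains S b \<beta> where "card S = card {j..}"
    "\<And>s t. s \<in> S \<Longrightarrow> t \<in> S \<Longrightarrow> s \<bullet> t = (if s = t then 1 else 0)"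
    "\<And>s. s \<in> S \<Longrightarrow> s \<bullet> b = 0" "norm b = 1" "\<beta> \<in> borel_measurable borel"
    "\<And>y. (\<Sum>s\<in>S. (s \<bullet> y)\<^sup>2) \<le> \<beta> y" "\<And>y. \<beta> y \<le> (norm y)\<^sup>2" "\<And>y. (b \<bullet> y)\<^sup>2 \<le> \<beta> y"
    "\<And>y. rho (\<lambda>i. transpose v *v (x(j := y)) i) j / rho (x(j := y)) j = (\<Sum>s\<in>S. (s \<bullet> y)\<^sup>2) / \<beta> y"
proof -
  let ?P = "\<lambda>y. transpose v *v y"
  have lin: "linear ?P" by (rule matrix_vector_mul_linear)
  define X where "X = x ` {..<j}"
  define W where "W = span (?P ` X)"
  have PX: "(\<lambda>i. ?P (x i)) ` {..<j} = ?P ` X" by (simp add: X_def image_image)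
  define N where "N = {b. \<forall>w\<in>W. orthogonal w b}"
  have "subspace N" unfolding N_def by (rule subspace_orthogonal_to_vectors)
  then obtain Bs where Bs: "Bs \<subseteq> N" "pairwise orthogonal Bs" "\<And>b. b \<in> Bs \<Longrightarrow> norm b = 1"
    "independent Bs" "card Bs = dim N" "span Bs = N"
    by (rule orthonormal_basis_subspace) blast
  have finB: "finite Bs" using Bs(4) by (rule independent_imp_finite)
  have "dim {y \<in> UNIV. \<forall>w\<in>W. orthogonal w y} + dim W = dim (UNIV :: (real^('m::{finite,linorder})) set)"
    by (rule dim_subspace_orthogonal_to_vectors) (auto simp: W_def)
  moreover have "dim W = card {..<j}"
    unfolding W_def PX[symmetric] dim_span by (rule gram_nonzero_dim[OF g])
  ultimately have "dim N + card {..<j} = CARD('m)" by (simp add: N_def dim_UNIV)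
  moreover have "card {j..} + card {..<j} = CARD('m)"
  proof -
    have "{j..} = UNIV - {..<j}" by auto
    thus ?thesis by (simp add: card_Diff_subset card_mono)
  qed
  ultimately have dN: "card Bs = card {j..}" using Bs(5) by simp
  have mj: "card {j..} + card {..<j} = CARD('m)" by fact
  \<comment> \<open>Since a . v'y = (v a) . y and v is an isometry, an orthonormal basis of the
    complement of W is carried to an orthonormal set S in the larger space, where it projects y
    itself.\<close>
  define S where "S = (*v) v ` Bs"
  have vin: "inj ((*v) v)"
  proof (rule injI)
    fix a b assume "v *v a = v *v b"
    hence "v *v (a - b) = 0" by (simp add: matrix_vector_mult_diff_distrib)
    hence "(a - b) \<bullet> (a - b) = 0" using stiefel_inner[OF v, of "a - b" "a - b"] by simp
    thus "a = b" by simp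
  qed
  have cS: "card S = card {j..}" unfolding S_def dN[symmetric] by (rule card_image) (use vin in \<open>auto simp: inj_def inj_on_def\<close>)
  have onS: "s \<bullet> t = (if s = t then 1 else 0)" if "s \<in> S" "t \<in> S" for s t
  proof -
    obtain a b where ab: "a \<in> Bs" "b \<in> Bs" "s = v *v a" "t = v *v b" using \<open>s \<in> S\<close> \<open>t \<in> S\<close> unfolding S_def by blast
    have "a \<bullet> b = (if a = b then 1 else 0)"
      using Bs(2,3) ab by (auto simp: pairwise_def orthogonal_def norm_eq_1)
    moreover have "s = t \<longleftrightarrow> a = b" using ab vin by (auto simp: inj_def)
    ultimately show ?thesis using ab stiefel_inner[OF v] by simp
  qed
  have sumS: "(\<Sum>s\<in>S. (s \<bullet> y)\<^sup>2) = (infdist (?P y) W)\<^sup>2" for y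
  proof -
    obtain z where z: "z \<in> W" "\<And>b. b \<in> W \<Longrightarrow> (?P y - z) \<bullet> b = 0" "infdist (?P y) W = norm (?P y - z)"
      using span_projection_exists[of "?P ` X" "?P y"] unfolding W_def by metis
    have "?P y - z \<in> span Bs" unfolding Bs(6) N_def using z(2) by (auto simp: orthogonal_def inner_commute)
    hence "(infdist (?P y) W)\<^sup>2 = (\<Sum>b\<in>Bs. (b \<bullet> (?P y - z))\<^sup>2)"
      unfolding z(3) using Bs finB by (intro orthonormal_sum_sq[symmetric]) auto
    also have "\<dots> = (\<Sum>b\<in>Bs. ((v *v b) \<bullet> y)\<^sup>2)"
    proof (rule sum.cong[OF refl])
      fix b assume "b \<in> Bs"
      hence "b \<bullet> z = 0" using Bs(1) z(1) by (auto simp: N_def orthogonal_def inner_commute)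
      thus "(b \<bullet> (?P y - z))\<^sup>2 = ((v *v b) \<bullet> y)\<^sup>2"
        unfolding inner_diff_right inner_transpose_mult by simp
    qed
    also have "\<dots> = (\<Sum>s\<in>S. (s \<bullet> y)\<^sup>2)"
      unfolding S_def using vin by (subst sum.reindex) (auto simp: inj_def inj_on_def)
    finally show ?thesis ..
  qed
  \<comment> \<open>There are fewer than j earlier columns and S fills the count up to m, so m < n
    leaves a direction orthogonal to both.\<close>
  have "dim (X \<union> S) \<le> card (X \<union> S)" by (rule dim_le_card') (simp add: X_def S_def finB)
  also have "\<dots> \<le> card X + card S" by (rule card_Un_le)
  also have "\<dots> \<le> card {..<j} + card {j..}" unfolding cS X_def by (simp add: card_image_le)
  also have "\<dots> < DIM(real^'n)" using mj mn by simp
  finally obtain b0 where b0: "b0 \<noteq> 0" "\<And>y. y \<in> span (X \<union> S) \<Longrightarrow> orthogonal b0 y"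
    by (rule orthogonal_to_subspace_exists) blast
  define b where "b = b0 /\<^sub>R norm b0"
  have b1: "norm b = 1" using b0(1) by (simp add: b_def)
  have b2: "y \<bullet> b = 0" "b \<bullet> y = 0" if "y \<in> span (X \<union> S)" for y
    using b0(2)[OF that] by (simp_all add: b_def orthogonal_def inner_commute)
  define \<beta> where "\<beta> y = (infdist y (span X))\<^sup>2" for y
  have gx: "gram x {..<j} \<noteq> 0"
    using gram_contraction[OF lin stiefel_norm_le[OF v], of x "{..<j}"] gram_nonneg[of "\<lambda>i. ?P (x i)" "{..<j}"] g by simp
  show ?thesis
  proof (rule that[OF cS onS])
    show "s \<bullet> b = 0" if "s \<in> S" for s using that by (intro b2) (auto intro: span_base)
    show "norm b = 1" by (rule b1)
    show "\<beta> \<in> borel_measurable borel" unfolding \<beta>_def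
      by (intro borel_measurable_continuous_onI continuous_intros)
    show "(\<Sum>s\<in>S. (s \<bullet> y)\<^sup>2) \<le> \<beta> y" for y
      unfolding sumS \<beta>_def W_def
      by (intro power_mono infdist_span_linear_le lin stiefel_norm_le v infdist_nonneg)
    show "\<beta> y \<le> (norm y)\<^sup>2" for y
      unfolding \<beta>_def using infdist_le[OF span_0, of y X] by (intro power_mono infdist_nonneg) simp
    \<comment> \<open>The vector b is orthogonal to the nearest point z in the span of X, so b . y =
      b . (y - z), and Cauchy-Schwarz applies.\<close>
    show "(b \<bullet> y)\<^sup>2 \<le> \<beta> y" for y
    proof -
      obtain z where z: "z \<in> span X" "infdist y (span X) = norm (y - z)"
        using span_projection_exists[of X y] by metis
      have "z \<in> span (X \<union> S)" using z(1) span_mono[of X "X \<union> S"] by auto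
      hence "b \<bullet> y = b \<bullet> (y - z)" using b2 by (simp add: inner_diff_right)
      hence "\<bar>b \<bullet> y\<bar> \<le> norm (y - z)" using Cauchy_Schwarz_ineq2[of b "y - z"] b1 by simp
      hence "\<bar>b \<bullet> y\<bar>\<^sup>2 \<le> (norm (y - z))\<^sup>2" by (intro power_mono) auto
      thus ?thesis by (simp add: \<beta>_def z(2))
    qed
    show "rho (\<lambda>i. ?P ((x(j := y)) i)) j / rho (x(j := y)) j = (\<Sum>s\<in>S. (s \<bullet> y)\<^sup>2) / \<beta> y" for y
    proof -
      have 1: "gram (\<lambda>i. ?P ((x(j := y)) i)) {..<j} = gram (\<lambda>i. ?P (x i)) {..<j}"
        "gram (x(j := y)) {..<j} = gram x {..<j}" by (rule gram_cong; auto)+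
      have im: "(\<lambda>i. ?P ((x(j := y)) i)) ` {..<j} = ?P ` X" "(x(j := y)) ` {..<j} = X"
        by (auto simp: X_def)
      have "rho (\<lambda>i. ?P ((x(j := y)) i)) j = (infdist (?P y) W)\<^sup>2"
        using g by (subst rho_infdist) (simp_all only: 1 im W_def fun_upd_same not_False_eq_True)
      moreover have "rho (x(j := y)) j = \<beta> y"
        using gx by (subst rho_infdist) (simp_all only: 1 im \<beta>_def fun_upd_same not_False_eq_True)
      ultimately show ?thesis by (simp add: sumS)
    qed
  qed
qed

text \<open>The last column occurs only in the last factor, and its integral has bounds free of the
  other columns. Removing it leaves the same problem for a shorter initial segment, so the constants
  multiply.\<close>

lemma columns_integral_bounds:
  fixes mu :: "'m::{finite,linorder} \<Rightarrow> real"
  assumes mn: "CARD('m::{finite,linorder}) < CARD('n::finite)"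
  obtains c C :: ennreal where "0 < c"
    "(\<And>j. mu j > - real (card {j..})) \<Longrightarrow> C < \<infinity>"
    "(\<exists>j. mu j \<le> - real (card {j..})) \<Longrightarrow> c = \<infinity>"
    "\<And>v :: real^('m::{finite,linorder})^('n::finite). v \<in> stiefel \<Longrightarrow>
      c \<le> (\<integral>\<^sup>+x. (\<Prod>j\<in>UNIV. ennreal ((rho (\<lambda>i. transpose v *v x i) j / rho x j) powr (mu j / 2))) \<partial>PiM UNIV (\<lambda>_. ballm)) \<and>
      (\<integral>\<^sup>+x. (\<Prod>j\<in>UNIV. ennreal ((rho (\<lambda>i. transpose v *v x i) j / rho x j) powr (mu j / 2))) \<partial>PiM UNIV (\<lambda>_. ballm)) \<le> C"
proof -
  interpret ballm: finite_measure "ballm :: (real^'n) measure" by (rule finite_measure_ballm)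
  interpret product_sigma_finite "\<lambda>_::'m. ballm :: (real^'n) measure" ..
  \<comment> \<open>Bundling the properties lets the constants be chosen for each j before v and x
    are quantified.\<close>
  define Q where "Q j c C \<longleftrightarrow> 0 < c \<and> (mu j > - real (card {j..}) \<longrightarrow> C < \<infinity>) \<and>
      (mu j \<le> - real (card {j..}) \<longrightarrow> c = \<infinity>) \<and>
      (\<forall>(v :: real^('m::{finite,linorder})^'n) x. v \<in> stiefel \<longrightarrow> gram (\<lambda>i. transpose v *v x i) {..<j} \<noteq> 0 \<longrightarrow>
       c \<le> (\<integral>\<^sup>+y. ennreal ((rho (\<lambda>i. transpose v *v (x(j := y)) i) j / rho (x(j := y)) j) powr (mu j / 2)) \<partial>ballm) \<and>
       (\<integral>\<^sup>+y. ennreal ((rho (\<lambda>i. transpose v *v (x(j := y)) i) j / rho (x(j := y)) j) powr (mu j / 2)) \<partial>ballm) \<le> C)" for j and c C :: ennreal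
  have "\<exists>c C. Q j c C" for j
  proof -
    have "card {j..} > 0" by (auto simp: card_gt_0_iff)
    hence k1: "1 \<le> card {j..}" by (simp only: Suc_le_eq One_nat_def)
    have k2: "card {j..} < CARD('n)" 
      by (rule le_less_trans[OF card_mono[OF finite subset_UNIV] mn])
    show ?thesis
    proof (rule projection_ratio_bounds[OF k1 k2, where mu = "mu j"], goal_cases)
      case (1 c C)
      have "c \<le> (\<integral>\<^sup>+y. ennreal ((rho (\<lambda>i. transpose v *v (x(j := y)) i) j / rho (x(j := y)) j) powr (mu j / 2)) \<partial>ballm) \<and>
       (\<integral>\<^sup>+y. ennreal ((rho (\<lambda>i. transpose v *v (x(j := y)) i) j / rho (x(j := y)) j) powr (mu j / 2)) \<partial>ballm) \<le> C"
        if v: "v \<in> stiefel" and g: "gram (\<lambda>i. transpose v *v x i) {..<j} \<noteq> 0"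
        for v :: "real^('m::{finite,linorder})^'n" and x
      proof -
        note bound = 1(4)
        show ?thesis
        proof (rule rho_ratio_as_projection[OF v mn g], goal_cases)
          case (1 S b \<beta>)
          show ?case unfolding 1(9) by (rule bound[OF 1(1-8)])
        qed
      qed
      moreover have "mu j > - real (card {j..}) \<longrightarrow> C < \<infinity>" "mu j \<le> - real (card {j..}) \<longrightarrow> c = \<infinity>"
        using 1(2,3) by simp_all
      ultimately show ?case unfolding Q_def using 1(1) by blast
    qed
  qed
  then obtain c C where Q: "\<And>j. Q j (c j) (C j)" by metis
  have cC: "\<And>j. 0 < c j" "\<And>j. mu j > - real (card {j..}) \<Longrightarrow> C j < \<infinity>"
    "\<And>j. mu j \<le> - real (card {j..}) \<Longrightarrow> c j = \<infinity>"
    "\<And>j (v :: real^('m::{finite,linorder})^'n) x. v \<in> stiefel \<Longrightarrow> gram (\<lambda>i. transpose v *v x i) {..<j} \<noteq> 0 \<Longrightarrow>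
       c j \<le> (\<integral>\<^sup>+y. ennreal ((rho (\<lambda>i. transpose v *v (x(j := y)) i) j / rho (x(j := y)) j) powr (mu j / 2)) \<partial>ballm)"
    "\<And>j (v :: real^('m::{finite,linorder})^'n) x. v \<in> stiefel \<Longrightarrow> gram (\<lambda>i. transpose v *v x i) {..<j} \<noteq> 0 \<Longrightarrow>
       (\<integral>\<^sup>+y. ennreal ((rho (\<lambda>i. transpose v *v (x(j := y)) i) j / rho (x(j := y)) j) powr (mu j / 2)) \<partial>ballm) \<le> C j"
    using Q unfolding Q_def by blast+
  show ?thesis
  proof (rule that)
    show "0 < (\<Prod>j\<in>UNIV. c j)" using cC(1) by (simp add: zero_less_iff_neq_zero prod_zero_iff)
    show "(\<Prod>j\<in>UNIV. C j) < \<infinity>" if "\<And>j. mu j > - real (card {j..})"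
      using cC(2)[OF that] by (simp add: less_top[symmetric] ennreal_prod_eq_top)
    \<comment> \<open>One infinite factor decides the product because the remaining ones are
      positive; in \<open>ennreal\<close> a zero factor would annihilate it.\<close>
    show "(\<Prod>j\<in>UNIV. c j) = \<infinity>" if "\<exists>j. mu j \<le> - real (card {j..})"
      using cC(1,3) that by (auto simp: ennreal_prod_eq_top zero_less_iff_neq_zero)
  next
    fix v :: "real^('m::{finite,linorder})^'n" assume v: "v \<in> stiefel"
    define F where "F x j = ennreal ((rho (\<lambda>i. transpose v *v x i) j / rho x j) powr (mu j / 2))" for x :: "'m \<Rightarrow> real^'n" and j
    have [measurable]: "(*v) (transpose v) \<in> borel_measurable borel"
      by (intro borel_measurable_continuous_onI matrix_vector_mult_linear_continuous_on)
    have mF: "(\<lambda>x. F x j) \<in> borel_measurable (PiM A (\<lambda>_. ballm))" if "{..j} \<subseteq> A" for A j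
    proof -
      have [measurable]: "(\<lambda>x. x i) \<in> borel_measurable (PiM A (\<lambda>_. ballm))" if "i \<le> j" for i
        using measurable_component_singleton[of i A "\<lambda>_. ballm :: (real^'n) measure"] that \<open>{..j} \<subseteq> A\<close>
        by (auto simp: measurable_cong_sets[OF refl sets_ballm])
      have "(\<lambda>x. rho x j) \<in> borel_measurable (PiM A (\<lambda>_. ballm :: (real^'n) measure))"
        by (rule borel_measurable_rho) measurable
      moreover have "(\<lambda>x. rho (\<lambda>i. transpose v *v x i) j) \<in> borel_measurable (PiM A (\<lambda>_. ballm :: (real^'n) measure))"
        by (rule borel_measurable_rho) measurable
      ultimately show ?thesis unfolding F_def by measurable
    qed
    \<comment> \<open>The sets A are initial segments, so the factors indexed by A depend only on
      columns indexed by A and the integral over \<open>PiM A\<close> makes sense.\<close>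
    have "(\<Prod>j\<in>A. c j) \<le> (\<integral>\<^sup>+x. (\<Prod>j\<in>A. F x j) \<partial>PiM A (\<lambda>_. ballm)) \<and>
        (\<integral>\<^sup>+x. (\<Prod>j\<in>A. F x j) \<partial>PiM A (\<lambda>_. ballm)) \<le> (\<Prod>j\<in>A. C j)"
      if "\<And>i k. k \<in> A \<Longrightarrow> i < k \<Longrightarrow> i \<in> A" for A
    proof -
      have "finite A" by simp
      thus ?thesis using that
      proof (induction A rule: finite_linorder_max_induct)
        case empty
        show ?case by (simp add: PiM_empty nn_integral_count_space_finite)
      next
        case (insert j A)
        have A: "A = {..<j}" using insert.hyps insert.prems by fastforce
        have IH: "(\<Prod>j\<in>A. c j) \<le> (\<integral>\<^sup>+x. (\<Prod>j\<in>A. F x j) \<partial>PiM A (\<lambda>_. ballm))"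
          "(\<integral>\<^sup>+x. (\<Prod>j\<in>A. F x j) \<partial>PiM A (\<lambda>_. ballm)) \<le> (\<Prod>j\<in>A. C j)"
          using insert.IH unfolding A by auto
        have mA: "(\<lambda>x. \<Prod>j\<in>A. F x j) \<in> borel_measurable (PiM A (\<lambda>_. ballm))"
          by (intro borel_measurable_prod_ennreal mF) (auto simp: A)
        have jA: "j \<notin> A" by (simp add: A)
        have "(\<integral>\<^sup>+x. (\<Prod>j\<in>insert j A. F x j) \<partial>PiM (insert j A) (\<lambda>_. ballm))
          = (\<integral>\<^sup>+x. (\<integral>\<^sup>+y. (\<Prod>k\<in>insert j A. F (x(j := y)) k) \<partial>ballm) \<partial>PiM A (\<lambda>_. ballm))"
        proof (rule product_nn_integral_insert)
          show "(\<lambda>x. \<Prod>k\<in>insert j A. F x k) \<in> borel_measurable (PiM (insert j A) (\<lambda>_. ballm))"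
            by (intro borel_measurable_prod_ennreal mF) (auto simp: A)
        qed (use jA in simp_all)
        also have "\<dots> = (\<integral>\<^sup>+x. (\<Prod>k\<in>A. F x k) * (\<integral>\<^sup>+y. F (x(j := y)) j \<partial>ballm) \<partial>PiM A (\<lambda>_. ballm))"
        proof (rule nn_integral_cong)
          fix x assume x: "x \<in> space (PiM A (\<lambda>_. ballm :: (real^'n) measure))"
          have "(\<Prod>k\<in>insert j A. F (x(j := y)) k) = (\<Prod>k\<in>A. F x k) * F (x(j := y)) j" for y
          proof -
            have "F (x(j := y)) k = F x k" if "k \<in> A" for k
            proof -
              have "rho (x(j := y)) k = rho x k" "rho (\<lambda>i. transpose v *v (x(j := y)) i) k = rho (\<lambda>i. transpose v *v x i) k"
                using that by (auto intro!: rho_cong simp: A)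
              thus ?thesis by (simp add: F_def)
            qed
            thus ?thesis using jA by (simp add: mult.commute)
          qed
          moreover have "(\<lambda>y. F (x(j := y)) j) \<in> borel_measurable ballm"
          proof -
            have "(\<lambda>y. x(j := y)) \<in> measurable ballm (PiM (insert j A) (\<lambda>_. ballm :: (real^'n) measure))"
              using x by (intro measurable_fun_upd[where J = A]) auto
            from measurable_compose[OF this mF[of j "insert j A"]] show ?thesis by (simp add: A atMost_insert)
          qed
          ultimately show "(\<integral>\<^sup>+y. (\<Prod>k\<in>insert j A. F (x(j := y)) k) \<partial>ballm) = (\<Prod>k\<in>A. F x k) * (\<integral>\<^sup>+y. F (x(j := y)) j \<partial>ballm)"
            by (simp add: nn_integral_cmult)
        qed
        finally have eq: "(\<integral>\<^sup>+x. (\<Prod>j\<in>insert j A. F x j) \<partial>PiM (insert j A) (\<lambda>_. ballm))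
          = (\<integral>\<^sup>+x. (\<Prod>k\<in>A. F x k) * (\<integral>\<^sup>+y. F (x(j := y)) j \<partial>ballm) \<partial>PiM A (\<lambda>_. ballm))" .
        \<comment> \<open>The column bounds require independent images of the earlier columns. If
          these are dependent, some earlier factor is 0 (as \<open>0 powr\<close> is 0) and both
          inequalities read 0 <= 0, even for an infinite constant.\<close>
        have b: "(\<Prod>k\<in>A. F x k) * c j \<le> (\<Prod>k\<in>A. F x k) * (\<integral>\<^sup>+y. F (x(j := y)) j \<partial>ballm)"
          "(\<Prod>k\<in>A. F x k) * (\<integral>\<^sup>+y. F (x(j := y)) j \<partial>ballm) \<le> (\<Prod>k\<in>A. F x k) * C j" for x
        proof -
          have "c j \<le> (\<integral>\<^sup>+y. F (x(j := y)) j \<partial>ballm) \<and> (\<integral>\<^sup>+y. F (x(j := y)) j \<partial>ballm) \<le> C j"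
            if nz: "(\<Prod>k\<in>A. F x k) \<noteq> 0"
          proof -
            have "rho (\<lambda>i. transpose v *v x i) k \<noteq> 0" if "k < j" for k
            proof
              assume "rho (\<lambda>i. transpose v *v x i) k = 0"
              hence "F x k = 0" by (simp add: F_def)
              thus False using nz that by (auto simp: A)
            qed
            hence "gram (\<lambda>i. transpose v *v x i) {..<j} \<noteq> 0" by (rule gram_nonzero_if_rho_nonzero)
            thus ?thesis unfolding F_def using cC(4,5)[OF v] by blast
          qed
          note * = this
          have "(\<Prod>k\<in>A. F x k) * c j \<le> (\<Prod>k\<in>A. F x k) * (\<integral>\<^sup>+y. F (x(j := y)) j \<partial>ballm) \<and>
            (\<Prod>k\<in>A. F x k) * (\<integral>\<^sup>+y. F (x(j := y)) j \<partial>ballm) \<le> (\<Prod>k\<in>A. F x k) * C j"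
          proof (cases "(\<Prod>k\<in>A. F x k) = 0")
            case False
            show ?thesis using *[OF False] by (blast intro: mult_left_mono zero_le)
          next
            case True
            show ?thesis unfolding True by simp
          qed
          thus "(\<Prod>k\<in>A. F x k) * c j \<le> (\<Prod>k\<in>A. F x k) * (\<integral>\<^sup>+y. F (x(j := y)) j \<partial>ballm)"
            "(\<Prod>k\<in>A. F x k) * (\<integral>\<^sup>+y. F (x(j := y)) j \<partial>ballm) \<le> (\<Prod>k\<in>A. F x k) * C j"
            by blast+
        qed
        have "(\<Prod>j\<in>insert j A. c j) = (\<Prod>j\<in>A. c j) * c j" using jA by (simp add: mult.commute)
        also have "\<dots> \<le> (\<integral>\<^sup>+x. (\<Prod>j\<in>A. F x j) \<partial>PiM A (\<lambda>_. ballm)) * c j"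
          by (intro mult_right_mono IH) simp
        also have "\<dots> = (\<integral>\<^sup>+x. (\<Prod>k\<in>A. F x k) * c j \<partial>PiM A (\<lambda>_. ballm))"
          by (rule nn_integral_multc[symmetric, OF mA])
        also have "\<dots> \<le> (\<integral>\<^sup>+x. (\<Prod>j\<in>insert j A. F x j) \<partial>PiM (insert j A) (\<lambda>_. ballm))"
          unfolding eq by (intro nn_integral_mono b)
        finally have 1: "(\<Prod>j\<in>insert j A. c j) \<le> (\<integral>\<^sup>+x. (\<Prod>j\<in>insert j A. F x j) \<partial>PiM (insert j A) (\<lambda>_. ballm))" .
        have "(\<integral>\<^sup>+x. (\<Prod>j\<in>insert j A. F x j) \<partial>PiM (insert j A) (\<lambda>_. ballm)) \<le> (\<integral>\<^sup>+x. (\<Prod>k\<in>A. F x k) * C j \<partial>PiM A (\<lambda>_. ballm))"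
          unfolding eq by (intro nn_integral_mono b)
        also have "\<dots> = (\<integral>\<^sup>+x. (\<Prod>j\<in>A. F x j) \<partial>PiM A (\<lambda>_. ballm)) * C j"
          by (rule nn_integral_multc[OF mA])
        also have "\<dots> \<le> (\<Prod>j\<in>A. C j) * C j" by (intro mult_right_mono IH) simp
        also have "\<dots> = (\<Prod>j\<in>insert j A. C j)" using jA by (simp add: mult.commute)
        finally show ?case using 1 by blast
      qed
    qed
    from this[of UNIV] show "(\<Prod>j\<in>UNIV. c j) \<le> (\<integral>\<^sup>+x. (\<Prod>j\<in>UNIV. ennreal ((rho (\<lambda>i. transpose v *v x i) j / rho x j) powr (mu j / 2))) \<partial>PiM UNIV (\<lambda>_. ballm)) \<and>
      (\<integral>\<^sup>+x. (\<Prod>j\<in>UNIV. ennreal ((rho (\<lambda>i. transpose v *v x i) j / rho x j) powr (mu j / 2))) \<partial>PiM UNIV (\<lambda>_. ballm)) \<le> (\<Prod>j\<in>UNIV. C j)"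
      unfolding F_def by simp
  qed
qed

section \<open>The kernel on the Stiefel manifold\<close>

definition cols :: "real^'m^'n \<Rightarrow> 'm \<Rightarrow> real^'n" where "cols u i = column i u"

lemma stiefel_iff_cols:
  "u \<in> stiefel \<longleftrightarrow> (\<forall>i k. cols u i \<bullet> cols u k = (if i = k then 1 else 0))"
  by (simp add: stiefel_def matrix_matrix_mult_def transpose_def mat_def vec_eq_iff cols_def column_def inner_vec_def)

lemma cols_mult: "cols (g ** u) i = g *v cols u i"
  by (simp add: cols_def column_def vec_eq_iff matrix_matrix_mult_def matrix_vector_mult_def)

lemma stiefel_transitive:
  assumes "CARD('m::finite) < CARD('n::finite)"
  obtains E :: "real^'m^'n" where "E \<in> stiefel"
    "\<And>u. u \<in> stiefel \<Longrightarrow> \<exists>g. orthogonal_matrix g \<and> u = g ** E"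
proof -
  \<comment> \<open>The reference frame E consists of m distinct axis vectors; extending the columns
    of u to an orthogonal matrix then moves E to u.\<close>
  obtain \<iota> :: "'m \<Rightarrow> 'n" where \<iota>: "inj \<iota>"
    using card_le_inj[of "UNIV :: 'm set" "UNIV :: 'n set"] assms by auto
  define E :: "real^'m^'n" where "E = (\<chi> r i. if r = \<iota> i then 1 else 0)"
  have cE: "cols E i = axis (\<iota> i) 1" for i
    by (auto simp: cols_def column_def E_def axis_def vec_eq_iff)
  have "E \<in> stiefel" unfolding stiefel_iff_cols cE using \<iota>
    by (auto simp: inner_axis_axis inj_def)
  moreover have "\<exists>g. orthogonal_matrix g \<and> u = g ** E" if u: "u \<in> stiefel" for u
  proof -
    define a where "a k = cols u (inv \<iota> k)" for k
    have "a i \<bullet> a k = (if i = k then 1 else 0)" if "i \<in> range \<iota>" "k \<in> range \<iota>" for i k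
      using that u \<iota> by (auto simp: a_def stiefel_iff_cols inj_def)
    then obtain g :: "real^'n^'n" where g: "orthogonal_matrix g" "\<And>i. i \<in> range \<iota> \<Longrightarrow> g *v axis i 1 = a i"
      using orthonormal_extend[of "range \<iota>" a] by blast
    have "cols u i = cols (g ** E) i" for i
      unfolding cols_mult cE using g(2)[of "\<iota> i"] \<iota> by (simp add: a_def)
    hence "u = g ** E" by (simp add: cols_def column_def vec_eq_iff)
    thus ?thesis using g(1) by blast
  qed
  ultimately show ?thesis by (rule that)
qed

text \<open>This is the quotient of consecutive leading minors of u'vv'u, because that matrix is the
  Gram matrix of the columns of v'u.\<close>

definition srho :: "real^('m::{finite,linorder})^'n \<Rightarrow> real^('m::{finite,linorder})^'n \<Rightarrow> 'm \<Rightarrow> real" where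
  "srho u v j = rho (\<lambda>i. transpose v *v cols u i) j"

lemma srho_nonneg: "srho u v j \<ge> 0"
  by (simp add: srho_def rho_nonneg)

lemma srho_le_1:
  fixes u v :: "real^('m::{finite,linorder})^'n"
  assumes "u \<in> stiefel" "v \<in> stiefel"
  shows "srho u v j \<le> 1"
proof -
  have "srho u v j \<le> (norm (transpose v *v cols u j))\<^sup>2" unfolding srho_def by (rule rho_le_norm)
  also have "\<dots> \<le> (norm (cols u j))\<^sup>2" using stiefel_norm_le[OF assms(2)] by (intro power_mono) auto
  also have "\<dots> = 1" using assms(1) by (simp add: stiefel_iff_cols power2_norm_eq_inner)
  finally show ?thesis .
qed

lemma srho_invariant:
  assumes "orthogonal_matrix g"
  shows "srho (g ** u) (g ** v) j = srho u v j"
proof -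
  have "transpose (g ** v) *v cols (g ** u) i = transpose v *v cols u i" for i
  proof -
    have "transpose (g ** v) *v cols (g ** u) i = (transpose v ** (transpose g ** g)) *v cols u i"
      by (simp only: cols_mult matrix_transpose_mul matrix_vector_mul_assoc matrix_mul_assoc)
    thus ?thesis using assms by (simp only: orthogonal_matrix matrix_mul_rid)
  qed
  thus ?thesis by (simp only: srho_def)
qed

lemma gram_matrix_nth: "(transpose w ** w) $ i $ k = cols w i \<bullet> cols w k" for w :: "real^'m^'n"
  by (simp add: matrix_matrix_mult_def transpose_def cols_def column_def inner_vec_def)

lemma comp_power_eq_srho:
  fixes u v :: "real^('m::{finite,linorder})^'n"
  shows "comp_power (transpose u ** v ** transpose v ** u) lam
    = (\<Prod>j\<in>UNIV. complex_of_real (srho u v j) powr (lam $ j / 2))"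
proof -
  let ?r = "transpose u ** v ** transpose v ** u"
  have "?r $ i $ k = (transpose v *v cols u i) \<bullet> (transpose v *v cols u k)" for i k
  proof -
    have "?r = transpose (transpose v ** u) ** (transpose v ** u)"
      by (simp add: matrix_transpose_mul matrix_mul_assoc)
    hence "?r $ i $ k = cols (transpose v ** u) i \<bullet> cols (transpose v ** u) k"
      by (simp only: gram_matrix_nth)
    thus ?thesis by (simp only: cols_mult)
  qed
  hence pm: "principal_minor ?r S = gram (\<lambda>i. transpose v *v cols u i) S" for S
    unfolding gram_def by (intro principal_minor_cong) simp
  show ?thesis
    unfolding comp_power_def pm srho_def rho_def atMost_def lessThan_def ..
qed

definition ker :: "real^('m::{finite,linorder})^'n \<Rightarrow> real^('m::{finite,linorder})^'n \<Rightarrow> ('m \<Rightarrow> real) \<Rightarrow> real" where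
  "ker u v mu = (\<Prod>j\<in>UNIV. srho u v j powr (mu j / 2))"

lemma ker_nonneg: "ker u v mu \<ge> 0"
  by (simp add: ker_def prod_nonneg)

lemma cmod_comp_power:
  "cmod (comp_power (transpose u ** v ** transpose v ** u) lam) = ker u v (\<lambda>j. Re (lam $ j))"
  unfolding comp_power_eq_srho ker_def prod_norm[symmetric]
  by (intro prod.cong refl) (simp add: norm_powr_real_powr srho_nonneg)

lemma ker_antimono:
  assumes "u \<in> stiefel" "v \<in> stiefel" "\<And>j. mu j \<le> mu' j"
  shows "ker u v mu' \<le> ker u v mu"
  unfolding ker_def
  using assms srho_nonneg srho_le_1
  by (intro prod_mono conjI powr_mono') auto

lemma ker_invariant: "orthogonal_matrix g \<Longrightarrow> ker (g ** u) (g ** v) mu = ker u v mu"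
  by (simp add: ker_def srho_invariant)

lemma borel_measurable_cols [measurable]: "(\<lambda>u :: real^'m^'n. cols u i) \<in> borel_measurable borel"
  unfolding cols_def column_def by (intro borel_measurable_continuous_onI continuous_intros)

lemma borel_measurable_transpose_mult [measurable]:
  fixes b :: "'a \<Rightarrow> real^'m^'n"
  assumes [measurable]: "a \<in> borel_measurable N" "b \<in> borel_measurable N"
  shows "(\<lambda>x. transpose (b x) *v (a x)) \<in> borel_measurable N"
proof -
  have "(\<lambda>p::(real^'n) \<times> (real^'m^'n). transpose (snd p) *v fst p) =
    (\<lambda>p. \<chi> k. \<Sum>r\<in>UNIV. snd p $ r $ k * fst p $ r)"
    unfolding matrix_vector_mult_def transpose_def by simp
  moreover have "continuous_on UNIV (\<lambda>p::(real^'n) \<times> (real^'m^'n). \<chi> k. \<Sum>r\<in>UNIV. snd p $ r $ k * fst p $ r)"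
    by (intro continuous_intros)
  ultimately have "(\<lambda>p::(real^'n) \<times> (real^'m^'n). transpose (snd p) *v fst p) \<in> borel_measurable (borel \<Otimes>\<^sub>M borel)"
    unfolding borel_prod by (simp add: borel_measurable_continuous_onI)
  from measurable_compose[OF _ this, of "\<lambda>x. (a x, b x)" N] show ?thesis by simp
qed

lemma borel_measurable_srho [measurable]:
  assumes [measurable]: "a \<in> borel_measurable N" "b \<in> borel_measurable N"
  shows "(\<lambda>x. srho (a x) (b x) j) \<in> borel_measurable N"
  unfolding srho_def
  by (rule borel_measurable_rho) (rule borel_measurable_transpose_mult; measurable)

lemma borel_measurable_ker [measurable]:
  assumes [measurable]: "a \<in> borel_measurable N" "b \<in> borel_measurable N"
  shows "(\<lambda>x. ker (a x) (b x) mu) \<in> borel_measurable N"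
  unfolding ker_def by measurable

text \<open>Rewrites the complex power through \<open>exp\<close> and the real logarithm, which
  makes measurability in the base immediate, with the value 0 at base 0 split off.\<close>

lemma powr_of_real_nonneg:
  "x \<ge> 0 \<Longrightarrow> complex_of_real x powr c = (if x = 0 then 0 else exp (c * complex_of_real (ln x)))"
  by (simp add: powr_def Ln_of_real)

lemma borel_measurable_comp_power [measurable]:
  fixes a b :: "'b \<Rightarrow> real^('m::{finite,linorder})^('n::finite)"
  assumes [measurable]: "a \<in> borel_measurable N" "b \<in> borel_measurable N"
  shows "(\<lambda>x. comp_power (transpose (a x) ** b x ** transpose (b x) ** a x) lam) \<in> borel_measurable N"
proof -
  have [measurable]: "(exp :: complex \<Rightarrow> complex) \<in> borel_measurable borel"
    by (intro borel_measurable_continuous_onI continuous_intros)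
  have "(\<lambda>x. \<Prod>j\<in>UNIV. if srho (a x) (b x) j = 0 then 0
     else exp (lam $ j / 2 * complex_of_real (ln (srho (a x) (b x) j)))) \<in> borel_measurable N"
    by measurable
  thus ?thesis by (simp only: comp_power_eq_srho powr_of_real_nonneg[OF srho_nonneg])
qed

section \<open>Integrals of the kernel against the invariant measure\<close>

locale stiefel_haar =
  fixes M :: "(real^('m::{finite,linorder})^('n::finite)) measure"
  assumes mn: "CARD('m) < CARD('n)" and inv: "stiefel_invariant_measure M"
begin

lemma sets_M [measurable_cong]: "sets M = sets borel"
  using inv by (simp add: stiefel_invariant_measure_def)

lemma space_M [simp]: "space M = UNIV"
  using sets_eq_imp_space_eq[OF sets_M] by simp

lemma closed_stiefel: "closed (stiefel :: (real^('m::{finite,linorder})^'n) set)"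
proof -
  have "stiefel = (\<Inter>i. \<Inter>k. {u :: real^('m::{finite,linorder})^'n. (\<Sum>r\<in>UNIV. u $ r $ i * u $ r $ k) = (if i = k then 1 else 0)})"
    by (auto simp: stiefel_iff_cols cols_def column_def inner_vec_def)
  also have "closed \<dots>"
    by (intro closed_INT ballI closed_Collect_eq continuous_intros)
  finally show ?thesis .
qed

lemma AE_stiefel: "AE v in M. v \<in> stiefel"
proof -
  have "UNIV - stiefel \<in> sets M" using closed_stiefel unfolding sets_M by simp
  moreover have "emeasure M (UNIV - stiefel) = 0" using inv by (simp add: stiefel_invariant_measure_def)
  ultimately have "UNIV - stiefel \<in> null_sets M" by auto
  thus ?thesis by (rule AE_I') auto
qed

lemma emeasure_M: "emeasure M UNIV = emeasure M stiefel"
  using AE_stiefel closed_stiefel by (intro emeasure_eq_AE) (auto simp: sets_M)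

lemma emeasure_M_pos: "emeasure M UNIV \<noteq> 0"
  using inv unfolding emeasure_M stiefel_invariant_measure_def by (metis less_irrefl)

lemma emeasure_M_fin: "emeasure M UNIV \<noteq> \<top>"
  using inv unfolding emeasure_M stiefel_invariant_measure_def infinity_ennreal_def by (metis less_irrefl)

sublocale finite_measure M
  by standard (simp add: emeasure_M_fin)

sublocale pair: pair_sigma_finite M M ..

lemma nn_integral_invariant:
  assumes "orthogonal_matrix g" and [measurable]: "h \<in> borel_measurable borel"
  shows "(\<integral>\<^sup>+v. h (g ** v) \<partial>M) = (\<integral>\<^sup>+v. h v \<partial>M)"
proof -
  have "(\<lambda>v. g ** v) = (\<lambda>v. \<chi> r i. \<Sum>k\<in>UNIV. g $ r $ k * (v :: real^('m::{finite,linorder})^'n) $ k $ i)"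
    by (simp add: matrix_matrix_mult_def)
  moreover have "continuous_on UNIV (\<lambda>v. \<chi> r i. \<Sum>k\<in>UNIV. g $ r $ k * (v :: real^('m::{finite,linorder})^'n) $ k $ i)"
    by (intro continuous_intros)
  ultimately have "(\<lambda>v. g ** (v :: real^('m::{finite,linorder})^'n)) \<in> borel_measurable borel"
    by (simp add: borel_measurable_continuous_onI)
  hence [measurable]: "(\<lambda>v. g ** v) \<in> measurable M M"
    by (simp add: measurable_cong_sets[OF sets_M sets_M])
  have "distr M M (\<lambda>v. g ** v) = M" using inv assms(1) by (simp add: stiefel_invariant_measure_def)
  hence "(\<integral>\<^sup>+v. h v \<partial>M) = (\<integral>\<^sup>+v. h v \<partial>distr M M (\<lambda>v. g ** v))" by simp
  also have "\<dots> = (\<integral>\<^sup>+v. h (g ** v) \<partial>M)" by (rule nn_integral_distr) measurable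
  finally show ?thesis ..
qed

text \<open>The kernel is unchanged when u and v are rotated together. Transitivity therefore makes
  each one-variable integral constant on frames, and Fubini on M x M forces the two constants to
  agree.\<close>

lemma ker_integral_constant:
  obtains I where "\<And>u. u \<in> stiefel \<Longrightarrow> (\<integral>\<^sup>+v. ennreal (ker u v mu) \<partial>M) = I"
    "\<And>v. v \<in> stiefel \<Longrightarrow> (\<integral>\<^sup>+u. ennreal (ker u v mu) \<partial>M) = I"
proof -
  obtain E :: "real^('m::{finite,linorder})^'n" where E: "E \<in> stiefel" "\<And>u. u \<in> stiefel \<Longrightarrow> \<exists>g. orthogonal_matrix g \<and> u = g ** E"
    using stiefel_transitive[OF mn] by metis
  define I J where "I = (\<integral>\<^sup>+v. ennreal (ker E v mu) \<partial>M)" and "J = (\<integral>\<^sup>+u. ennreal (ker u E mu) \<partial>M)"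
  have I: "(\<integral>\<^sup>+v. ennreal (ker u v mu) \<partial>M) = I" if u: "u \<in> stiefel" for u
  proof -
    obtain g where g: "orthogonal_matrix g" "u = g ** E" using E(2)[OF u] by blast
    have "(\<integral>\<^sup>+v. ennreal (ker u v mu) \<partial>M) = (\<integral>\<^sup>+v. ennreal (ker u (g ** v) mu) \<partial>M)"
      by (rule nn_integral_invariant[OF g(1), symmetric]) measurable
    thus ?thesis by (simp add: g(2) ker_invariant[OF g(1)] I_def)
  qed
  have J: "(\<integral>\<^sup>+u. ennreal (ker u v mu) \<partial>M) = J" if v: "v \<in> stiefel" for v
  proof -
    obtain g where g: "orthogonal_matrix g" "v = g ** E" using E(2)[OF v] by blast
    have "(\<integral>\<^sup>+u. ennreal (ker u v mu) \<partial>M) = (\<integral>\<^sup>+u. ennreal (ker (g ** u) v mu) \<partial>M)"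
      by (rule nn_integral_invariant[OF g(1), symmetric]) measurable
    thus ?thesis by (simp add: g(2) ker_invariant[OF g(1)] J_def)
  qed
  have "I * emeasure M UNIV = (\<integral>\<^sup>+u. (\<integral>\<^sup>+v. ennreal (ker u v mu) \<partial>M) \<partial>M)"
  proof -
    have "AE u in M. (\<integral>\<^sup>+v. ennreal (ker u v mu) \<partial>M) = I" using AE_stiefel by eventually_elim (rule I)
    from nn_integral_cong_AE[OF this] show ?thesis by simp
  qed
  also have "\<dots> = (\<integral>\<^sup>+v. (\<integral>\<^sup>+u. ennreal (ker u v mu) \<partial>M) \<partial>M)"
    by (rule pair.Fubini') measurable
  also have "\<dots> = J * emeasure M UNIV"
  proof -
    have "AE v in M. (\<integral>\<^sup>+u. ennreal (ker u v mu) \<partial>M) = J" using AE_stiefel by eventually_elim (rule J)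
    from nn_integral_cong_AE[OF this] show ?thesis by simp
  qed
  finally have "emeasure M UNIV * I = emeasure M UNIV * J" by (simp add: mult.commute)
  hence "I = J" using emeasure_M_pos emeasure_M_fin by (simp add: ennreal_mult_cancel_left)
  with I J that show ?thesis by simp
qed

text \<open>For independent columns, Gram-Schmidt scales \<open>rho\<close> of x and of v'x by the
  same c_j^2, so the ratios are those of a frame. If some \<open>rho x j\<close> is 0, division by
  zero makes that ratio, hence its power, 0; this explains the indicator.\<close>

lemma column_ratio_integral:
  fixes x :: "'m \<Rightarrow> real^'n"
  assumes I: "\<And>u. u \<in> stiefel \<Longrightarrow> (\<integral>\<^sup>+v. ennreal (ker u v mu) \<partial>M) = I"
  shows "(\<integral>\<^sup>+v. (\<Prod>j\<in>UNIV. ennreal ((rho (\<lambda>i. transpose v *v x i) j / rho x j) powr (mu j / 2))) \<partial>M)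
    = I * indicator {x. \<forall>j. rho x j \<noteq> 0} x"
proof (cases "\<forall>j. rho x j \<noteq> 0")
  case True
  obtain w c where w: "\<And>i k. w i \<bullet> w k = (if i = k then 1 else 0)"
    "\<And>j. c j \<noteq> 0" "\<And>j. x j - c j *\<^sub>R w j \<in> span (w ` {..<j})" "\<And>j. (c j)\<^sup>2 = rho x j"
    using gram_schmidt[of x] True by metis
  define u :: "real^('m::{finite,linorder})^'n" where "u = (\<chi> r i. w i $ r)"
  have cu: "cols u i = w i" for i by (simp add: cols_def column_def u_def vec_eq_iff)
  have u: "u \<in> stiefel" unfolding stiefel_iff_cols cu using w(1) by simp
  have "rho (\<lambda>i. transpose v *v x i) j / rho x j = srho u v j" for v :: "real^('m::{finite,linorder})^'n" and j
  proof -
    have lin: "linear ((*v) (transpose v))" by (rule matrix_vector_mul_linear)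
    have "rho (\<lambda>i. transpose v *v x i) j = (c j)\<^sup>2 * rho (\<lambda>i. transpose v *v w i) j"
    proof (rule rho_triangular[OF _ w(2)])
      fix j
      have "transpose v *v (x j - c j *\<^sub>R w j) \<in> (*v) (transpose v) ` span (w ` {..<j})"
        using w(3) by blast
      also have "\<dots> = span ((*v) (transpose v) ` w ` {..<j})" by (rule linear_span_image[OF lin, symmetric])
      also have "(*v) (transpose v) ` w ` {..<j} = (\<lambda>i. transpose v *v w i) ` {..<j}" by (simp only: image_image)
      also have "transpose v *v (x j - c j *\<^sub>R w j) = transpose v *v x j - c j *\<^sub>R (transpose v *v w j)"
        by (simp only: linear_diff[OF lin] linear_scale[OF lin])
      finally show "transpose v *v x j - c j *\<^sub>R (transpose v *v w j) \<in> span ((\<lambda>i. transpose v *v w i) ` {..<j})" .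
    qed
    hence "rho (\<lambda>i. transpose v *v x i) j / rho x j = (c j)\<^sup>2 * rho (\<lambda>i. transpose v *v w i) j / (c j)\<^sup>2"
      by (simp only: w(4))
    also have "\<dots> = rho (\<lambda>i. transpose v *v w i) j" using w(2)[of j] by (simp only: nonzero_mult_div_cancel_left power_not_zero not_False_eq_True)
    finally show ?thesis by (simp only: srho_def cu)
  qed
  hence "(\<integral>\<^sup>+v. (\<Prod>j\<in>UNIV. ennreal ((rho (\<lambda>i. transpose v *v x i) j / rho x j) powr (mu j / 2))) \<partial>M)
      = (\<integral>\<^sup>+v. ennreal (ker u v mu) \<partial>M)"
    by (simp add: ker_def prod_ennreal)
  thus ?thesis using I[OF u] True by simp
next
  case False
  then obtain j where "rho x j = 0" by blast
  hence "(\<Prod>j\<in>UNIV. ennreal ((rho (\<lambda>i. transpose v *v x i) j / rho x j) powr (mu j / 2))) = 0" for v :: "real^('m::{finite,linorder})^'n"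
    by (intro prod_zero) (auto intro!: exI[of _ j])
  thus ?thesis using False by (simp only:) simp
qed

text \<open>One double integral is evaluated in both orders: integrating v first gives I times the
  mass of the independent tuples, integrating x first gives a value between c and C times the mass
  of M.\<close>

lemma ker_integral_finite_iff:
  assumes I: "\<And>u. u \<in> stiefel \<Longrightarrow> (\<integral>\<^sup>+v. ennreal (ker u v mu) \<partial>M) = I"
  shows "I < \<top> \<longleftrightarrow> (\<forall>j. mu j > - real (card {j..}))"
proof -
  interpret ballm: finite_measure "ballm :: (real^'n) measure" by (rule finite_measure_ballm)
  interpret product_sigma_finite "\<lambda>_::'m. ballm :: (real^'n) measure" ..
  define N where "N = PiM UNIV (\<lambda>_::'m. ballm :: (real^'n) measure)"
  have "emeasure N (space N) = (\<Prod>i\<in>(UNIV::'m set). emeasure (ballm :: (real^'n) measure) UNIV)"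
    unfolding N_def space_PiM space_ballm by (rule emeasure_PiM) auto
  also have "\<dots> < \<top>" using ballm.emeasure_finite[of UNIV] by (simp add: less_top[symmetric] power_eq_top_ennreal)
  finally have Nfin: "emeasure N (space N) \<noteq> \<top>" by (simp add: less_top)
  interpret N: finite_measure N by standard (use Nfin in simp)
  interpret MN: pair_sigma_finite N M ..
  have comp [measurable]: "(\<lambda>x. x i) \<in> borel_measurable N" for i
    using measurable_component_singleton[of i UNIV "\<lambda>_::'m. ballm :: (real^'n) measure"]
    by (simp add: N_def measurable_cong_sets[OF refl sets_ballm])
  have [measurable]: "(\<lambda>x. rho x j) \<in> borel_measurable N" for j
    by (rule borel_measurable_rho) measurable
  have [measurable]: "(\<lambda>p. rho (\<lambda>i. transpose (snd p) *v fst p i) j) \<in> borel_measurable (N \<Otimes>\<^sub>M M)" for j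
    by (rule borel_measurable_rho) measurable
  define G where "G = {x \<in> space N. \<forall>j. rho x j \<noteq> 0}"
  have G [measurable]: "G \<in> sets N" unfolding G_def by measurable
  let ?H = "\<lambda>x v. \<Prod>j\<in>UNIV. ennreal ((rho (\<lambda>i. transpose v *v x i) j / rho x j) powr (mu j / 2))"
  have "(\<integral>\<^sup>+v. (\<integral>\<^sup>+x. ?H x v \<partial>N) \<partial>M) = (\<integral>\<^sup>+x. (\<integral>\<^sup>+v. ?H x v \<partial>M) \<partial>N)"
    by (rule MN.Fubini') measurable
  also have "\<dots> = (\<integral>\<^sup>+x. I * indicator G x \<partial>N)"
    by (rule nn_integral_cong, subst column_ratio_integral[OF I]) (auto simp: G_def indicator_def)
  also have "\<dots> = I * emeasure N G" by (rule nn_integral_cmult_indicator[OF G])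
  finally have eq: "(\<integral>\<^sup>+v. (\<integral>\<^sup>+x. ?H x v \<partial>N) \<partial>M) = I * emeasure N G" .
  have Gfin: "emeasure N G < \<top>" using N.emeasure_finite[of G] by (simp add: less_top[symmetric])
  have "I < \<top> \<longleftrightarrow> (\<forall>j. mu j > - real (card {j..}))"
  proof (rule columns_integral_bounds[OF mn, where mu = mu], goal_cases)
    case (1 c C)
    have b: "AE v in M. c \<le> (\<integral>\<^sup>+x. ?H x v \<partial>N)" "AE v in M. (\<integral>\<^sup>+x. ?H x v \<partial>N) \<le> C"
      unfolding N_def using AE_stiefel by (eventually_elim, use 1(4) in blast)+
    have lo: "c * emeasure M UNIV \<le> I * emeasure N G"
      using nn_integral_mono_AE[OF b(1)] unfolding eq by simp
    have up: "I * emeasure N G \<le> C * emeasure M UNIV"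
      using nn_integral_mono_AE[OF b(2)] unfolding eq by simp
    \<comment> \<open>The lower bound also shows that the independent tuples have positive mass, so
      no separate argument is made that the dependent ones form a null set.\<close>
    have pos: "I * emeasure N G \<noteq> 0" using lo 1(1) emeasure_M_pos by auto
    show ?case
    proof
      assume "\<forall>j. mu j > - real (card {j..})"
      hence "C < \<infinity>" using 1(2) by blast
      hence "C * emeasure M UNIV < \<top>" using emeasure_M_fin by (auto simp: ennreal_mult_eq_top_iff less_top[symmetric])
      hence "I * emeasure N G < \<top>" using up by (rule le_less_trans[rotated])
      thus "I < \<top>" using pos by (auto simp: ennreal_mult_less_top)
    next
      assume fin: "I < \<top>"
      show "\<forall>j. mu j > - real (card {j..})"
      proof (rule ccontr)
        assume "\<not> ?thesis"
        hence "\<exists>j. mu j \<le> - real (card {j..})" by (auto simp: not_less)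
        hence "c = \<infinity>" using 1(3) by blast
        hence "I * emeasure N G = \<top>" using lo emeasure_M_pos by (simp add: ennreal_top_mult top_unique)
        thus False using fin Gfin by (auto simp: ennreal_mult_eq_top_iff)
      qed
    qed
  qed
  thus ?thesis .
qed

text \<open>With one-based positions, m + 1 - j counts the indices from j upwards, which is the rank
  met in the column integrals.\<close>

lemma stiefel_domain_iff:
  "(lam :: complex^('m::{finite,linorder})) \<in> stiefel_domain \<longleftrightarrow> (\<forall>j. Re (lam $ j) > - real (card {j..}))"
proof -
  have "real (idx_pos j) - real CARD('m) - 1 = - real (card {j..})" for j :: 'm
  proof -
    have "UNIV = {j..} \<union> {..<j}" by auto
    hence "CARD('m) = card {j..} + card {..<j}" by (subst card_Un_disjoint[symmetric]) auto
    moreover have "idx_pos j = card {..<j} + 1" by (simp add: idx_pos_def lessThan_def)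
    ultimately show ?thesis by simp
  qed
  thus ?thesis by (simp only: stiefel_domain_def mem_Collect_eq)
qed

abbreviation "K lam u v \<equiv> comp_power (transpose u ** v ** transpose v ** u) lam"

text \<open>After Tonelli the inner u-integral is the constant I. This one identity yields both
  absolute convergence for almost every u and the bound on the operator.\<close>

lemma ker_double_integral:
  fixes f :: "real^('m::{finite,linorder})^'n \<Rightarrow> complex"
  assumes I: "\<And>v. v \<in> stiefel \<Longrightarrow> (\<integral>\<^sup>+u. ennreal (ker u v mu) \<partial>M) = I"
    and [measurable]: "f \<in> borel_measurable M"
  shows "(\<integral>\<^sup>+u. (\<integral>\<^sup>+v. ennreal (cmod (f v) * ker u v mu) \<partial>M) \<partial>M) = I * (\<integral>\<^sup>+v. ennreal (cmod (f v)) \<partial>M)"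
proof -
  have "(\<integral>\<^sup>+u. (\<integral>\<^sup>+v. ennreal (cmod (f v) * ker u v mu) \<partial>M) \<partial>M)
    = (\<integral>\<^sup>+v. (\<integral>\<^sup>+u. ennreal (cmod (f v) * ker u v mu) \<partial>M) \<partial>M)"
    by (rule pair.Fubini') measurable
  also have "\<dots> = (\<integral>\<^sup>+v. I * ennreal (cmod (f v)) \<partial>M)"
  proof (rule nn_integral_cong_AE)
    show "AE v in M. (\<integral>\<^sup>+u. ennreal (cmod (f v) * ker u v mu) \<partial>M) = I * ennreal (cmod (f v))"
      using AE_stiefel
    proof eventually_elim
      case (elim v)
      have "(\<integral>\<^sup>+u. ennreal (cmod (f v) * ker u v mu) \<partial>M) = (\<integral>\<^sup>+u. ennreal (cmod (f v)) * ennreal (ker u v mu) \<partial>M)"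
        by (simp add: ennreal_mult ker_nonneg)
      also have "\<dots> = ennreal (cmod (f v)) * (\<integral>\<^sup>+u. ennreal (ker u v mu) \<partial>M)"
        by (rule nn_integral_cmult) measurable
      finally show ?case by (simp add: I[OF elim] mult.commute)
    qed
  qed
  also have "\<dots> = I * (\<integral>\<^sup>+v. ennreal (cmod (f v)) \<partial>M)"
    by (rule nn_integral_cmult) measurable
  finally show ?thesis .
qed

lemma kernel_integrable_pair:
  fixes f :: "real^('m::{finite,linorder})^'n \<Rightarrow> complex"
  assumes lam: "lam \<in> stiefel_domain" and f: "integrable M f"
  shows "integrable (M \<Otimes>\<^sub>M M) (\<lambda>(u, v). f v * K lam u v)"
proof -
  have [measurable]: "f \<in> borel_measurable M" using f by auto
  obtain I where I: "\<And>u. u \<in> stiefel \<Longrightarrow> (\<integral>\<^sup>+v. ennreal (ker u v (\<lambda>j. Re (lam $ j))) \<partial>M) = I"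
    "\<And>v. v \<in> stiefel \<Longrightarrow> (\<integral>\<^sup>+u. ennreal (ker u v (\<lambda>j. Re (lam $ j))) \<partial>M) = I"
    using ker_integral_constant[of "\<lambda>j. Re (lam $ j)"] by metis
  have Ifin: "I < \<top>" using ker_integral_finite_iff[OF I(1)] lam by (simp add: stiefel_domain_iff)
  have mes: "(\<lambda>(u, v). f v * K lam u v) \<in> borel_measurable (M \<Otimes>\<^sub>M M)" by measurable
  show ?thesis
  proof (rule integrableI_bounded[OF mes])
    have "(\<integral>\<^sup>+p. ennreal (norm (case p of (u, v) \<Rightarrow> f v * K lam u v)) \<partial>(M \<Otimes>\<^sub>M M))
      = (\<integral>\<^sup>+u. (\<integral>\<^sup>+v. ennreal (norm (f v * K lam u v)) \<partial>M) \<partial>M)"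
      using mes by (subst nn_integral_fst[symmetric]) auto
    also have "\<dots> = I * (\<integral>\<^sup>+v. ennreal (cmod (f v)) \<partial>M)"
      unfolding norm_mult cmod_comp_power by (rule ker_double_integral[OF I(2)]) auto
    also have "\<dots> < \<infinity>" using Ifin f by (simp add: ennreal_mult_less_top integrable_iff_bounded)
    finally show "(\<integral>\<^sup>+p. ennreal (norm (case p of (u, v) \<Rightarrow> f v * K lam u v)) \<partial>(M \<Otimes>\<^sub>M M)) < \<infinity>" .
  qed
qed

lemma AE_kernel_integrable:
  fixes f :: "real^('m::{finite,linorder})^'n \<Rightarrow> complex"
  assumes "lam \<in> stiefel_domain" "integrable M f"
  shows "AE u in M. integrable M (\<lambda>v. f v * K lam u v)"
  using pair.AE_integrable_fst'[OF kernel_integrable_pair[OF assms]] by simp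

lemma in_domain_if_AE_integrable:
  assumes "AE u in M. integrable M (\<lambda>v. K lam u v)"
  shows "lam \<in> stiefel_domain"
proof -
  obtain I where I: "\<And>u. u \<in> stiefel \<Longrightarrow> (\<integral>\<^sup>+v. ennreal (ker u v (\<lambda>j. Re (lam $ j))) \<partial>M) = I"
    using ker_integral_constant[of "\<lambda>j. Re (lam $ j)"] by metis
  \<comment> \<open>The statement no longer depends on u; as M has positive mass, it holds
    outright.\<close>
  have "AE u in M. I < \<top>"
    using assms AE_stiefel
  proof eventually_elim
    case (elim u)
    thus ?case using I[OF elim(2)] by (simp add: integrable_iff_bounded cmod_comp_power)
  qed
  hence "I < \<top>" using emeasure_M_pos by (simp add: eventually_const_iff ae_filter_eq_bot_iff)
  thus ?thesis using ker_integral_finite_iff[OF I] by (simp add: stiefel_domain_iff)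
qed

text \<open>The bound obtained for the operator on L^1 is the constant I at the real parts of
  lambda.\<close>

lemma T_op_bounded:
  assumes lam: "lam \<in> stiefel_domain"
  obtains C :: real where "\<And>f. integrable M f \<Longrightarrow> integrable M (T_op M lam f)"
    "\<And>f. integrable M f \<Longrightarrow> (\<integral>u. cmod (T_op M lam f u) \<partial>M) \<le> C * (\<integral>v. cmod (f v) \<partial>M)"
proof -
  obtain I where I: "\<And>u. u \<in> stiefel \<Longrightarrow> (\<integral>\<^sup>+v. ennreal (ker u v (\<lambda>j. Re (lam $ j))) \<partial>M) = I"
    "\<And>v. v \<in> stiefel \<Longrightarrow> (\<integral>\<^sup>+u. ennreal (ker u v (\<lambda>j. Re (lam $ j))) \<partial>M) = I"
    using ker_integral_constant[of "\<lambda>j. Re (lam $ j)"] by metis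
  have Ifin: "I < \<top>" using ker_integral_finite_iff[OF I(1)] lam by (simp add: stiefel_domain_iff)
  have T: "integrable M (T_op M lam f)" if f: "integrable M f" for f
  proof -
    have "T_op M lam f = (\<lambda>u. \<integral>v. f v * K lam u v \<partial>M)" by (rule ext) (simp add: T_op_def)
    thus ?thesis using pair.integrable_fst'[OF kernel_integrable_pair[OF lam f]] by simp
  qed
  have "(\<integral>u. cmod (T_op M lam f u) \<partial>M) \<le> enn2real I * (\<integral>v. cmod (f v) \<partial>M)" if f: "integrable M f" for f
  proof -
    have [measurable]: "f \<in> borel_measurable M" using f by auto
    have "ennreal (\<integral>u. cmod (T_op M lam f u) \<partial>M) = (\<integral>\<^sup>+u. ennreal (cmod (T_op M lam f u)) \<partial>M)"
      using T[OF f] by (intro nn_integral_eq_integral[symmetric]) auto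
    also have "\<dots> \<le> (\<integral>\<^sup>+u. (\<integral>\<^sup>+v. ennreal (cmod (f v) * ker u v (\<lambda>j. Re (lam $ j))) \<partial>M) \<partial>M)"
    proof (rule nn_integral_mono_AE)
      show "AE u in M. ennreal (cmod (T_op M lam f u)) \<le> (\<integral>\<^sup>+v. ennreal (cmod (f v) * ker u v (\<lambda>j. Re (lam $ j))) \<partial>M)"
        using AE_kernel_integrable[OF lam f]
      proof eventually_elim
        case (elim u)
        show ?case unfolding T_op_def
          using integral_norm_bound_ennreal[OF elim] by (simp add: norm_mult cmod_comp_power)
      qed
    qed
    also have "\<dots> = I * (\<integral>\<^sup>+v. ennreal (cmod (f v)) \<partial>M)" by (rule ker_double_integral[OF I(2)]) auto
    also have "\<dots> = ennreal (enn2real I) * ennreal (\<integral>v. cmod (f v) \<partial>M)"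
      using Ifin f by (simp add: nn_integral_eq_integral)
    also have "\<dots> = ennreal (enn2real I * (\<integral>v. cmod (f v) \<partial>M))" by (simp add: ennreal_mult)
    finally show ?thesis by (subst (asm) ennreal_le_iff) simp_all
  qed
  with T that show ?thesis by blast
qed

end

section \<open>Second-order expansion of the kernel and analyticity\<close>

lemma cmod_exp_remainder_le:
  fixes w :: complex
  shows "cmod (exp w - 1 - w) \<le> (cmod w)\<^sup>2 * exp (cmod w)"
proof -
  have "cmod (exp w - (\<Sum>k\<le>1. w ^ k / fact k)) \<le> exp \<bar>Re w\<bar> * (cmod w) ^ Suc 1 / fact 1"
    by (rule Taylor_exp)
  also have "exp \<bar>Re w\<bar> * (cmod w) ^ Suc 1 / fact 1 \<le> (cmod w)\<^sup>2 * exp (cmod w)"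
    using abs_Re_le_cmod[of w] by (simp add: power2_eq_square mult.commute mult_right_mono)
  finally show ?thesis by (simp add: diff_diff_eq add.commute)
qed

lemma sq_le_exp: "x \<ge> 0 \<Longrightarrow> x\<^sup>2 \<le> 2 * exp (x::real)"
  using exp_lower_Taylor_quadratic[of x] by simp

lemma open_stiefel_domain: "open (stiefel_domain :: (complex^('m::{finite,linorder})) set)"
proof -
  have "stiefel_domain = (\<Inter>j. {lam :: complex^('m::{finite,linorder}). real (idx_pos j) - real CARD('m) - 1 < Re (lam $ j)})"
    by (auto simp: stiefel_domain_def)
  also have "open \<dots>" by (intro open_INT ballI open_Collect_less continuous_intros) auto
  finally show ?thesis .
qed

lemma comp_power_exp:
  assumes "\<And>j. srho u v j \<noteq> 0"
  shows "comp_power (transpose u ** v ** transpose v ** u) lam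
    = exp (\<Sum>j\<in>UNIV. lam $ j * complex_of_real (ln (srho u v j) / 2))"
  unfolding comp_power_eq_srho powr_of_real_nonneg[OF srho_nonneg] using assms
  by (simp add: exp_sum)

lemma comp_power_zero:
  assumes "srho u v j = 0"
  shows "comp_power (transpose u ** v ** transpose v ** u) lam = 0"
  unfolding comp_power_eq_srho using assms by (intro prod_zero) (auto intro!: exI[of _ j])

lemma ker_exp:
  assumes "\<And>j. srho u v j \<noteq> 0"
  shows "ker u v mu = exp (\<Sum>j\<in>UNIV. mu j * (ln (srho u v j) / 2))"
  unfolding ker_def powr_def using assms by (simp add: exp_sum)

text \<open>All a j are nonpositive. Lowering every real exponent by d therefore multiplies the
  modulus of the kernel by exp (d s) with s the sum of the -a j, and this exponential absorbs the
  powers of s produced by differentiation.\<close>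

lemma kernel_expansion:
  fixes u v :: "real^('m::{finite,linorder})^('n::finite)" and z h :: "complex^('m::{finite,linorder})"
  assumes u: "u \<in> stiefel" and v: "v \<in> stiefel" and d: "d > 0"
    and mu: "\<And>j. mu j \<le> Re (z $ j) - d"
  defines "a \<equiv> \<lambda>j. ln (srho u v j) / 2" and "K \<equiv> \<lambda>lam. comp_power (transpose u ** v ** transpose v ** u) lam"
  shows "cmod (complex_of_real (a j) * K z) \<le> 1 / d * ker u v mu"
    and "norm h \<le> d / 2 \<Longrightarrow>
      cmod (K (z + h) - K z - (\<Sum>j\<in>UNIV. h $ j * (complex_of_real (a j) * K z))) \<le> 8 / d\<^sup>2 * (norm h)\<^sup>2 * ker u v mu"
proof -
  have "cmod (complex_of_real (a j) * K z) \<le> 1 / d * ker u v mu \<and>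
    (norm h \<le> d / 2 \<longrightarrow> cmod (K (z + h) - K z - (\<Sum>j\<in>UNIV. h $ j * (complex_of_real (a j) * K z))) \<le> 8 / d\<^sup>2 * (norm h)\<^sup>2 * ker u v mu)"
  proof (cases "\<forall>j. srho u v j \<noteq> 0")
    \<comment> \<open>On the degenerate set the kernel is 0 for every lambda, so both left-hand
      sides vanish.\<close>
    case False
    then obtain i where i: "srho u v i = 0" by blast
    have "K lam = 0" for lam unfolding K_def by (rule comp_power_zero[OF i])
    thus ?thesis using d by (simp add: ker_nonneg)
  next
    case True
    have a: "a j \<le> 0" for j
    proof -
      have "srho u v j > 0" using True srho_nonneg[of u v j] by (simp add: order_less_le)
      thus ?thesis using srho_le_1[OF u v, of j] by (simp add: a_def ln_le_zero_iff)
    qed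
    define s where "s = (\<Sum>j\<in>UNIV. - a j)"
    have s: "s \<ge> 0" unfolding s_def using a by (intro sum_nonneg) simp
    have as: "\<bar>a j\<bar> \<le> s" for j
      using a member_le_sum[of j UNIV "\<lambda>j. - a j"] by (simp add: s_def)
    have Ke: "K lam = exp (\<Sum>j\<in>UNIV. lam $ j * complex_of_real (a j))" for lam
      unfolding K_def a_def by (rule comp_power_exp) (use True in blast)
    have "cmod (K z) * exp (d * s) = exp (\<Sum>j\<in>UNIV. (Re (z $ j) - d) * a j)"
      by (simp add: Ke s_def exp_add[symmetric] sum_distrib_left sum.distrib[symmetric] sum_negf sum_subtractf[symmetric] algebra_simps)
    also have "\<dots> \<le> exp (\<Sum>j\<in>UNIV. mu j * a j)"
      using mu a by (simp add: sum_mono mult_right_mono_neg)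
    also have "\<dots> = ker u v mu" unfolding a_def by (rule ker_exp[symmetric]) (use True in blast)
    finally have main: "cmod (K z) * exp (d * s) \<le> ker u v mu" .
    have "\<bar>a j\<bar> \<le> 1 / d * exp (d * s)"
    proof -
      have "d * s \<le> exp (d * s)" using exp_ge_add_one_self[of "d * s"] by linarith
      hence "s \<le> 1 / d * exp (d * s)" using d by (simp add: field_simps)
      thus ?thesis using as[of j] by linarith
    qed
    hence "\<bar>a j\<bar> * cmod (K z) \<le> (1 / d * exp (d * s)) * cmod (K z)" by (rule mult_right_mono) simp
    also have "\<dots> = 1 / d * (cmod (K z) * exp (d * s))" by simp
    also have "\<dots> \<le> 1 / d * ker u v mu" using main d by (intro mult_left_mono) auto
    finally have 1: "cmod (complex_of_real (a j) * K z) \<le> 1 / d * ker u v mu" by (simp add: norm_mult)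
    have 2: "cmod (K (z + h) - K z - (\<Sum>j\<in>UNIV. h $ j * (complex_of_real (a j) * K z))) \<le> 8 / d\<^sup>2 * (norm h)\<^sup>2 * ker u v mu"
      if h: "norm h \<le> d / 2"
    proof -
      define w where "w = (\<Sum>j\<in>UNIV. h $ j * complex_of_real (a j))"
      have "cmod w \<le> (\<Sum>j\<in>UNIV. norm h * (- a j))"
        unfolding w_def
      proof (rule order.trans[OF norm_sum sum_mono])
        fix j
        have "cmod (h $ j) * \<bar>a j\<bar> \<le> norm h * \<bar>a j\<bar>"
          by (intro mult_right_mono Finite_Cartesian_Product.norm_nth_le) simp
        thus "cmod (h $ j * complex_of_real (a j)) \<le> norm h * (- a j)"
          using a[of j] by (simp add: norm_mult)
      qed
      hence w: "cmod w \<le> norm h * s" by (simp add: s_def sum_distrib_left)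
      have "K (z + h) = K z * exp w"
        by (simp add: Ke w_def exp_add[symmetric] sum.distrib[symmetric] algebra_simps)
      moreover have "(\<Sum>j\<in>UNIV. h $ j * (complex_of_real (a j) * K z)) = K z * w"
        by (simp add: w_def sum_distrib_left algebra_simps)
      ultimately have "K (z + h) - K z - (\<Sum>j\<in>UNIV. h $ j * (complex_of_real (a j) * K z)) = K z * (exp w - 1 - w)"
        by (simp add: algebra_simps)
      hence "cmod (K (z + h) - K z - (\<Sum>j\<in>UNIV. h $ j * (complex_of_real (a j) * K z))) \<le> cmod (K z) * ((cmod w)\<^sup>2 * exp (cmod w))"
        using cmod_exp_remainder_le[of w] by (simp add: norm_mult mult_left_mono)
      also have "\<dots> \<le> cmod (K z) * ((norm h * s)\<^sup>2 * exp (d / 2 * s))"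
      proof (intro mult_left_mono mult_mono power_mono)
        have "norm h * s \<le> d / 2 * s" using h s by (rule mult_right_mono)
        thus "exp (cmod w) \<le> exp (d / 2 * s)" using w by simp
      qed (use w in auto)
      \<comment> \<open>The factor exp (d s) is spent in two halves: one dominates exp |w|, since
        |w| <= |h| s <= d s / 2, and the other dominates s^2. The latter, through x^2 <= 2 exp x at
        x = d s / 2, produces the constant 8 / d^2.\<close>
      also have "(norm h * s)\<^sup>2 * exp (d / 2 * s) \<le> 8 / d\<^sup>2 * (norm h)\<^sup>2 * exp (d * s)"
      proof -
        have "(d / 2 * s)\<^sup>2 \<le> 2 * exp (d / 2 * s)" using d s by (intro sq_le_exp) simp
        hence "s\<^sup>2 \<le> 8 / d\<^sup>2 * exp (d / 2 * s)" using d by (simp add: field_simps power2_eq_square)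
        hence "s\<^sup>2 * exp (d / 2 * s) \<le> 8 / d\<^sup>2 * exp (d / 2 * s) * exp (d / 2 * s)" by (rule mult_right_mono) simp
        also have "\<dots> = 8 / d\<^sup>2 * exp (d * s)" by (simp add: exp_add[symmetric])
        finally have "(norm h)\<^sup>2 * (s\<^sup>2 * exp (d / 2 * s)) \<le> (norm h)\<^sup>2 * (8 / d\<^sup>2 * exp (d * s))" by (rule mult_left_mono) simp
        thus ?thesis by (simp add: power_mult_distrib algebra_simps)
      qed
      hence "cmod (K z) * ((norm h * s)\<^sup>2 * exp (d / 2 * s)) \<le> cmod (K z) * (8 / d\<^sup>2 * (norm h)\<^sup>2 * exp (d * s))"
        by (rule mult_left_mono) simp
      also have "\<dots> = 8 / d\<^sup>2 * (norm h)\<^sup>2 * (cmod (K z) * exp (d * s))" by simp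
      also have "\<dots> \<le> 8 / d\<^sup>2 * (norm h)\<^sup>2 * ker u v mu" using main by (intro mult_left_mono) auto
      finally show ?thesis .
    qed
    show ?thesis using 1 2 by blast
  qed
  thus "cmod (complex_of_real (a j) * K z) \<le> 1 / d * ker u v mu"
    "norm h \<le> d / 2 \<Longrightarrow> cmod (K (z + h) - K z - (\<Sum>j\<in>UNIV. h $ j * (complex_of_real (a j) * K z))) \<le> 8 / d\<^sup>2 * (norm h)\<^sup>2 * ker u v mu"
    by blast+
qed

context stiefel_haar
begin

lemma kernel_integrable_mono:
  fixes f :: "real^('m::{finite,linorder})^'n \<Rightarrow> complex"
  assumes u: "u \<in> stiefel" and f: "integrable M f"
    and mu: "integrable M (\<lambda>v. cmod (f v) * ker u v mu)" "\<And>j. mu j \<le> Re (lam $ j)"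
  shows "integrable M (\<lambda>v. f v * K lam u v)"
proof (rule Bochner_Integration.integrable_bound[OF mu(1)])
  have [measurable]: "f \<in> borel_measurable M" using f by auto
  show "(\<lambda>v. f v * K lam u v) \<in> borel_measurable M" by measurable
  show "AE v in M. norm (f v * K lam u v) \<le> norm (cmod (f v) * ker u v mu)"
    using AE_stiefel
  proof eventually_elim
    case (elim v)
    have "ker u v (\<lambda>j. Re (lam $ j)) \<le> ker u v mu" by (rule ker_antimono[OF u elim mu(2)])
    thus ?case by (simp add: norm_mult cmod_comp_power ker_nonneg mult_left_mono)
  qed
qed

text \<open>Differentiation under the integral sign by an explicit quadratic remainder: the
  integrable function built from mu dominates both the candidate derivative and the second-order
  error. The candidate is a complex linear form in h, hence homogeneous over the complex
  numbers.\<close>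

lemma T_op_has_derivative:
  fixes f :: "real^('m::{finite,linorder})^'n \<Rightarrow> complex" and z :: "complex^('m::{finite,linorder})"
  assumes u: "u \<in> stiefel" and f: "integrable M f"
    and mu: "integrable M (\<lambda>v. cmod (f v) * ker u v mu)" and d: "d > 0" "\<And>j. mu j \<le> Re (z $ j) - d"
  obtains L where "((\<lambda>lam. T_op M lam f u) has_derivative L) (at z)" "\<And>c x. L (c *s x) = c * L x"
proof -
  have [measurable]: "f \<in> borel_measurable M" using f by auto
  define a where "a j v = complex_of_real (ln (srho u v j) / 2) * K z u v" for j v
  have ia: "integrable M (\<lambda>v. f v * a j v)" for j
  proof (rule Bochner_Integration.integrable_bound[OF integrable_mult_right[OF mu, of "1 / d"]])
    show "(\<lambda>v. f v * a j v) \<in> borel_measurable M" unfolding a_def by measurable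
    show "AE v in M. norm (f v * a j v) \<le> norm (1 / d * (cmod (f v) * ker u v mu))"
      using AE_stiefel
    proof eventually_elim
      case (elim v)
      have "cmod (a j v) \<le> 1 / d * ker u v mu"
        unfolding a_def by (rule kernel_expansion(1)[OF u elim d])
      hence "cmod (f v) * cmod (a j v) \<le> cmod (f v) * (1 / d * ker u v mu)" by (rule mult_left_mono) simp
      thus ?case using d by (simp add: norm_mult ker_nonneg)
    qed
  qed
  define c where "c j = (\<integral>v. f v * a j v \<partial>M)" for j
  define L where "L h = (\<Sum>j\<in>UNIV. h $ j * c j)" for h :: "complex^('m::{finite,linorder})"
  have blL: "bounded_linear L" unfolding L_def
    by (intro bounded_linear_sum bounded_linear_compose[OF bounded_linear_mult_left] bounded_linear_vec_nth)
  define B where "B = 8 / d\<^sup>2 * (\<integral>v. cmod (f v) * ker u v mu \<partial>M)"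
  \<comment> \<open>An increment of norm at most d / 2 lowers a real part by less than the margin d,
    so the shifted exponent stays above mu.\<close>
  have iz: "integrable M (\<lambda>v. f v * K (z + h) u v)" if "norm h \<le> d / 2" for h
  proof (rule kernel_integrable_mono[OF u f mu])
    fix j
    have "\<bar>Re (h $ j)\<bar> \<le> norm h" using abs_Re_le_cmod Finite_Cartesian_Product.norm_nth_le by (rule order.trans)
    thus "mu j \<le> Re ((z + h) $ j)" using that d(1) d(2)[of j] by simp
  qed
  have bound: "cmod (T_op M (z + h) f u - T_op M z f u - L h) \<le> B * (norm h)\<^sup>2" if h: "norm h \<le> d / 2" for h
  proof -
    let ?R = "\<lambda>v. f v * K (z + h) u v - f v * K z u v - (\<Sum>j\<in>UNIV. h $ j * (f v * a j v))"
    have i0: "integrable M (\<lambda>v. f v * K z u v)" using iz[of 0] d by simp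
    have iR: "integrable M ?R" using iz[OF h] i0 ia by (intro Bochner_Integration.integrable_diff Bochner_Integration.integrable_sum integrable_mult_right) auto
    have "T_op M (z + h) f u - T_op M z f u - L h = (\<integral>v. ?R v \<partial>M)"
      using iz[OF h] i0 ia by (simp add: T_op_def L_def c_def)
    hence "cmod (T_op M (z + h) f u - T_op M z f u - L h) = cmod (\<integral>v. ?R v \<partial>M)" by (rule arg_cong)
    also have "\<dots> \<le> (\<integral>v. cmod (?R v) \<partial>M)" by (rule integral_norm_bound)
    also have "\<dots> \<le> (\<integral>v. 8 / d\<^sup>2 * (norm h)\<^sup>2 * (cmod (f v) * ker u v mu) \<partial>M)"
    proof (rule integral_mono_AE)
      show "integrable M (\<lambda>v. cmod (?R v))" using iR by (rule integrable_norm)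
      show "integrable M (\<lambda>v. 8 / d\<^sup>2 * (norm h)\<^sup>2 * (cmod (f v) * ker u v mu))" using mu by (rule integrable_mult_right)
      show "AE v in M. cmod (?R v) \<le> 8 / d\<^sup>2 * (norm h)\<^sup>2 * (cmod (f v) * ker u v mu)"
        using AE_stiefel
      proof eventually_elim
        case (elim v)
        have "?R v = f v * (K (z + h) u v - K z u v - (\<Sum>j\<in>UNIV. h $ j * a j v))"
          unfolding right_diff_distrib sum_distrib_left by (simp only: mult.left_commute)
        hence "cmod (?R v) = cmod (f v) * cmod (K (z + h) u v - K z u v - (\<Sum>j\<in>UNIV. h $ j * a j v))"
          by (simp only: norm_mult)
        also have "\<dots> \<le> cmod (f v) * (8 / d\<^sup>2 * (norm h)\<^sup>2 * ker u v mu)"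
          unfolding a_def by (intro mult_left_mono kernel_expansion(2)[OF u elim d h]) simp
        also have "\<dots> = 8 / d\<^sup>2 * (norm h)\<^sup>2 * (cmod (f v) * ker u v mu)" by simp
        finally show ?case .
      qed
    qed
    also have "\<dots> = B * (norm h)\<^sup>2" by (simp add: B_def)
    finally show ?thesis .
  qed
  have "((\<lambda>lam. T_op M lam f u) has_derivative L) (at z)"
    unfolding has_derivative_at
  proof (intro conjI blL)
    have "eventually (\<lambda>h. norm (norm (T_op M (z + h) f u - T_op M z f u - L h) / norm h) \<le> B * norm h) (at 0)"
      unfolding eventually_at
    proof (intro exI[of _ "d / 2"] conjI ballI impI)
      fix h :: "complex^('m::{finite,linorder})" assume "h \<noteq> 0 \<and> dist h 0 < d / 2"
      hence "h \<noteq> 0" "norm h \<le> d / 2" by auto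
      thus "norm (norm (T_op M (z + h) f u - T_op M z f u - L h) / norm h) \<le> B * norm h"
        using bound[of h] by (simp add: divide_le_eq power2_eq_square algebra_simps)
    qed (use d in simp)
    moreover have "((\<lambda>h. B * norm h) \<longlongrightarrow> 0) (at (0 :: complex^('m::{finite,linorder})))"
      by (intro tendsto_eq_intros) auto
    ultimately show "((\<lambda>h. norm (T_op M (z + h) f u - T_op M z f u - L h) / norm h) \<longlongrightarrow> 0) (at 0)"
      by (rule Lim_null_comparison)
  qed
  moreover have "L (c *s x) = c * L x" for c x
    by (simp add: L_def sum_distrib_left mult.assoc)
  ultimately show ?thesis by (rule that)
qed

text \<open>The exponents mu n decrease to the boundary of the domain, so countably many null sets
  are discarded in total. For every remaining u each z of the domain lies above some mu n with room
  to spare, and the statements for single points apply.\<close>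

lemma AE_analytic:
  fixes f :: "real^('m::{finite,linorder})^'n \<Rightarrow> complex"
  assumes f: "integrable M f"
  shows "AE u in M. (\<forall>lam\<in>stiefel_domain. integrable M (\<lambda>v. f v * K lam u v)) \<and>
    holomorphic_multi (\<lambda>lam. T_op M lam f u) stiefel_domain"
proof -
  define mu where "mu n j = - real (card {j..}) + 1 / (real n + 1)" for n :: nat and j :: 'm
  have "AE u in M. integrable M (\<lambda>v. f v * K (\<chi> j. complex_of_real (mu n j)) u v)" for n
    by (rule AE_kernel_integrable[OF _ f]) (simp add: stiefel_domain_iff mu_def)
  hence "AE u in M. \<forall>n. integrable M (\<lambda>v. f v * K (\<chi> j. complex_of_real (mu n j)) u v)"
    by (simp add: AE_all_countable)
  thus ?thesis using AE_stiefel
  proof eventually_elim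
    case (elim u)
    have mu: "integrable M (\<lambda>v. cmod (f v) * ker u v (mu n))" for n
      using integrable_norm[OF spec[OF elim(1), of n]] by (simp add: norm_mult cmod_comp_power)
    have ex: "\<exists>n d. d > 0 \<and> (\<forall>j. mu n j \<le> Re (z $ j) - d)" if z: "z \<in> stiefel_domain" for z :: "complex^('m::{finite,linorder})"
    proof -
      \<comment> \<open>This e is the smallest distance of a real part to its threshold; half of it
        covers the offset 1 / (n + 1) of mu n and the other half is the margin d.\<close>
      define e where "e = Min (range (\<lambda>j. Re (z $ j) + real (card {j..})))"
      have "e \<in> range (\<lambda>j. Re (z $ j) + real (card {j..}))" unfolding e_def by (rule Min_in) auto
      hence e: "e > 0" using z by (auto simp: stiefel_domain_iff) (smt (verit))
      have e2: "e \<le> Re (z $ j) + real (card {j..})" for j unfolding e_def by (rule Min_le) auto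
      obtain n where "1 / real (Suc n) < e / 2" using nat_approx_posE[of "e / 2"] e by auto
      hence "mu n j \<le> Re (z $ j) - e / 2" for j using e2[of j] unfolding mu_def by (simp add: add.commute)
      thus ?thesis using e by (intro exI[of _ n] exI[of _ "e / 2"]) auto
    qed
    have "integrable M (\<lambda>v. f v * K lam u v)" if lam: "lam \<in> stiefel_domain" for lam
    proof -
      obtain n d where "d > 0" "\<And>j. mu n j \<le> Re (lam $ j) - d" using ex[OF lam] by blast
      hence "mu n j \<le> Re (lam $ j)" for j by (smt (verit))
      thus ?thesis by (rule kernel_integrable_mono[OF elim(2) f mu])
    qed
    moreover have "holomorphic_multi (\<lambda>lam. T_op M lam f u) stiefel_domain"
      unfolding holomorphic_multi_def
    proof (intro conjI ballI open_stiefel_domain)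
      fix z :: "complex^('m::{finite,linorder})" assume z: "z \<in> stiefel_domain"
      obtain n d where *: "d > 0" "\<And>j. mu n j \<le> Re (z $ j) - d" using ex[OF z] by blast
      show "\<exists>L. ((\<lambda>lam. T_op M lam f u) has_derivative L) (at z) \<and> (\<forall>c x. L (c *s x) = c * L x)"
        using T_op_has_derivative[OF elim(2) f mu *] by metis
    qed
    ultimately show ?case by blast
  qed
qed

end

theorem theorem4p1:
  fixes M :: "(real^('m::{finite,linorder})^('n::finite)) measure"
  assumes "CARD('m::{finite,linorder}) < CARD('n::finite)"
    and "stiefel_invariant_measure M"
  shows "(\<forall>lam::complex^('m::{finite,linorder}).
           (\<forall>f::real^('m::{finite,linorder})^('n::finite) \<Rightarrow> complex. integrable M f \<longrightarrow>
              (AE u in M. integrable M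
                 (\<lambda>v. f v * comp_power (transpose u ** v ** transpose v ** u) lam)))
           \<longleftrightarrow> lam \<in> stiefel_domain)
    \<and> (\<forall>f::real^('m::{finite,linorder})^('n::finite) \<Rightarrow> complex. integrable M f \<longrightarrow>
           (AE u in M. (\<forall>lam\<in>stiefel_domain. integrable M
                 (\<lambda>v. f v * comp_power (transpose u ** v ** transpose v ** u) lam))
              \<and> holomorphic_multi (\<lambda>lam. T_op M lam f u) stiefel_domain))
    \<and> (\<forall>lam\<in>stiefel_domain. \<exists>C::real. \<forall>f::real^('m::{finite,linorder})^('n::finite) \<Rightarrow> complex.
           integrable M f \<longrightarrow>
           integrable M (T_op M lam f) \<and>
           (\<integral>u. cmod (T_op M lam f u) \<partial>M) \<le> C * (\<integral>v. cmod (f v) \<partial>M))"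
proof -
  interpret stiefel_haar M by standard (fact assms)+
  \<comment> \<open>The constant function 1 is integrable because M is finite, so it may serve as
    the test function.\<close>
  have "lam \<in> stiefel_domain" if "\<forall>f::real^('m::{finite,linorder})^'n \<Rightarrow> complex. integrable M f \<longrightarrow>
              (AE u in M. integrable M (\<lambda>v. f v * comp_power (transpose u ** v ** transpose v ** u) lam))" for lam
    by (rule in_domain_if_AE_integrable) (use spec[OF that, of "\<lambda>_. 1"] in simp)
  moreover have "\<exists>C::real. \<forall>f::real^('m::{finite,linorder})^'n \<Rightarrow> complex. integrable M f \<longrightarrow>
      integrable M (T_op M lam f) \<and> (\<integral>u. cmod (T_op M lam f u) \<partial>M) \<le> C * (\<integral>v. cmod (f v) \<partial>M)"
    if "lam \<in> stiefel_domain" for lam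
    using T_op_bounded[OF that] by metis
  ultimately show ?thesis using AE_kernel_integrable AE_analytic by blast
qed

end
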